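(* Let $\rho\ge1$ and $0<\theta<\pi/2$ satisfy $0<\rho\cos\theta<1/2$, let $\Lambda\subset\mathbb{R}^2$ be the lattice generated by $(1,0)$ and $(\rho\cos\theta,\rho\sin\theta)$, and let $X=(X_1,X_2)$ be uniformly distributed on the Babai cell $\mathcal{B}(0)=(-1/2,1/2]\times(-\tfrac{\rho}{2}\sin\theta,\tfrac{\rho}{2}\sin\theta]$. Consider the single-round scheme with order $21$ (node $S_2$ speaks first) described in the context, with parameter $N$, messages $U_2,U_1$ and error probability $P_{e,II}$. With $$\kappa:=\lim_{N\to\infty}H(U_1\mid U_2)=\frac{2}{H}\int_{-\rho\sin\theta/2}^{\tau_{-1}}H(P(x))\,dx ,$$ the total number of bits sent is given by $$R=H(Q)+(1-Q_0)\log_2 N+\kappa ,$$ and $$P_{e,II}=\frac{\beta}{N},\qquad \beta=\frac12\cdot\frac{2L_2+L_1}{L}\cdot\frac{H_1}{H}.$$ Taking limits, $$\lim_{N\to\infty}P_{e,II}\,2^{R/(1-Q_0)}=\beta\,2^{(H(Q)+\kappa)/(1-Q_0)} .$$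
   Context: $H(\cdot)$ applied to a probability vector or discrete random variable (possibly conditional) is Shannon entropy in bits, while $H$ without argument denotes the number $H=\rho\sin\theta$, the height of $\mathcal{B}(0)$. Communicated bits are counted by entropy. $\mathcal{V}(\lambda)$ denotes the set of $x\in\mathbb{R}^2$ for which $\lambda\in\Lambda$ is a closest lattice point. Node $S_i$ knows only $X_i$, $i=1,2$, before communication. Constants: $L=1$ (the length of $\mathcal{B}(0)$), $L_1=(1-2\rho\cos\theta)/2$, $L_2=(\rho\cos\theta)/2$, $H_1=\dfrac{\cos\theta(1-\rho\cos\theta)}{2\sin\theta}$, $H_0=H-2H_1$, $\tau_1=H/2-H_1$, $\tau_{-1}=-\tau_1$; $Q=(H_0/H,H_1/H,H_1/H)$ and $Q_0=H_0/H$. For $x\in(-H/2,H/2]$, let $[l(x),r(x)]$ be the closure of the set of $x_1$ with $(x_1,x)\in\mathcal{B}(0)\cap\mathcal{V}(0)$ (left and right thresholds), and let $P(x)=(P_{-1}(x),P_0(x),P_1(x))$ be the probabilities of $X_1<l(x)$, $l(x)\le X_1\le r(x)$, $X_1>r(x)$ respectively. Scheme. The support of $X_2$ is divided into $2N+1$ bins: $J_0=(\tau_{-1},\tau_1]$ is a single bin, and each of $J_{-1}=(-H/2,\tau_{-1}]$ and $J_1=(\tau_1,H/2]$ is divided into $N$ equal-length bins. $S_2$ sends the index $U_2$ of the bin containing $X_2$. If $m$ is the midpoint of that bin, $S_1$ replies with $U_1=-1$ if $X_1<l(m)$, $U_1=1$ if $X_1>r(m)$, and $U_1=0$ otherwise.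 Thus $(U_2,U_1)$ identifies a rectangle $\mathcal{R}\subset\mathcal{B}(0)$ containing $X$, and the common decision is a lattice point $\lambda$ maximizing $\mathrm{Area}(\mathcal{R}\cap\mathcal{V}(\lambda))$ (this is $\lambda=0$ when $U_1=0$). $P_{e,II}$ is the probability that the decision differs from the lattice point closest to $X$.
   Formalization: The formula for R is false at finite N, as H(U1|U2) > κ by strict concavity of H(P(x)); it is replaced by R = H(Q)+(1−Q0)log2 N + H(U1|U2) for every N ≥ 1, plus R − (H(Q)+(1−Q0)log2 N+κ) → 0, and the final limit uses this actual R. *)

theory Defs
  imports "HOL-Probability.Probability"
begin

section \<open>The lattice, its Voronoi cells and the Babai cell\<close>

definition cell_height :: "real \<Rightarrow> real \<Rightarrow> real" where
  "cell_height \<rho> \<theta> = \<rho> * sin \<theta>"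

definition lambda_lattice :: "real \<Rightarrow> real \<Rightarrow> (real \<times> real) set" where
  "lambda_lattice \<rho> \<theta> =
     {real_of_int i *\<^sub>R (1, 0) + real_of_int j *\<^sub>R (\<rho> * cos \<theta>, \<rho> * sin \<theta>) | i j. True}"

text \<open>Closed cells: points on a common boundary belong to every closest lattice point.\<close>

definition voronoi :: "real \<Rightarrow> real \<Rightarrow> real \<times> real \<Rightarrow> (real \<times> real) set" where
  "voronoi \<rho> \<theta> v = {x. \<forall>w\<in>lambda_lattice \<rho> \<theta>. dist x v \<le> dist x w}"

definition babai_cell :: "real \<Rightarrow> real \<Rightarrow> (real \<times> real) set" where
  "babai_cell \<rho> \<theta> = {-1/2<..1/2} \<times> {-(\<rho>/2 * sin \<theta>)<..\<rho>/2 * sin \<theta>}"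


section \<open>Constants\<close>

definition cell_length :: real where
  "cell_length = 1"

definition L1 :: "real \<Rightarrow> real \<Rightarrow> real" where
  "L1 \<rho> \<theta> = (1 - 2 * \<rho> * cos \<theta>) / 2"

definition L2 :: "real \<Rightarrow> real \<Rightarrow> real" where
  "L2 \<rho> \<theta> = \<rho> * cos \<theta> / 2"

definition H1 :: "real \<Rightarrow> real \<Rightarrow> real" where
  "H1 \<rho> \<theta> = cos \<theta> * (1 - \<rho> * cos \<theta>) / (2 * sin \<theta>)"

definition H0 :: "real \<Rightarrow> real \<Rightarrow> real" where
  "H0 \<rho> \<theta> = cell_height \<rho> \<theta> - 2 * H1 \<rho> \<theta>"

definition tau1 :: "real \<Rightarrow> real \<Rightarrow> real" where
  "tau1 \<rho> \<theta> = cell_height \<rho> \<theta> / 2 - H1 \<rho> \<theta>"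

definition tau_m1 :: "real \<Rightarrow> real \<Rightarrow> real" where
  "tau_m1 \<rho> \<theta> = - tau1 \<rho> \<theta>"

definition Q0 :: "real \<Rightarrow> real \<Rightarrow> real" where
  "Q0 \<rho> \<theta> = H0 \<rho> \<theta> / cell_height \<rho> \<theta>"

definition Q :: "real \<Rightarrow> real \<Rightarrow> real list" where
  "Q \<rho> \<theta> = [H0 \<rho> \<theta> / cell_height \<rho> \<theta>, H1 \<rho> \<theta> / cell_height \<rho> \<theta>, H1 \<rho> \<theta> / cell_height \<rho> \<theta>]"

definition beta :: "real \<Rightarrow> real \<Rightarrow> real" where
  "beta \<rho> \<theta> = 1/2 * ((2 * L2 \<rho> \<theta> + L1 \<rho> \<theta>) / cell_length) * (H1 \<rho> \<theta> / cell_height \<rho> \<theta>)"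


section \<open>Entropy in bits\<close>

text \<open>Entropy of a probability vector; the convention \<open>0 log 0 = 0\<close> is automatic since
  the factor \<open>p\<close> vanishes.\<close>

definition vec_entropy :: "real list \<Rightarrow> real" where
  "vec_entropy ps = (\<Sum>p\<leftarrow>ps. - p * log 2 p)"

text \<open>The next two are the notations \<open>\<H>(U)\<close> and \<open>\<H>(U | V)\<close> of the locale
  \<open>information_space\<close> in base 2.\<close>

definition (in prob_space) rv_entropy :: "('a \<Rightarrow> 'b) \<Rightarrow> real" where
  "rv_entropy U = entropy 2 (count_space (U ` space M)) U"

definition (in prob_space) rv_cond_entropy :: "('a \<Rightarrow> 'b) \<Rightarrow> ('a \<Rightarrow> 'c) \<Rightarrow> real" where
  "rv_cond_entropy U V =
     conditional_entropy 2 (count_space (U ` space M)) (count_space (V ` space M)) U V"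


section \<open>Thresholds\<close>

text \<open>For \<open>-H/2 < x \<le> H/2\<close> the closure below is the compact interval \<open>[l(x), r(x)]\<close>, so its
  endpoints are its infimum and supremum.\<close>

definition section_closure :: "real \<Rightarrow> real \<Rightarrow> real \<Rightarrow> real set" where
  "section_closure \<rho> \<theta> x =
     closure {x1. (x1, x) \<in> babai_cell \<rho> \<theta> \<inter> voronoi \<rho> \<theta> (0, 0)}"

definition left_thr :: "real \<Rightarrow> real \<Rightarrow> real \<Rightarrow> real" where
  "left_thr \<rho> \<theta> x = Inf (section_closure \<rho> \<theta> x)"

definition right_thr :: "real \<Rightarrow> real \<Rightarrow> real \<Rightarrow> real" where
  "right_thr \<rho> \<theta> x = Sup (section_closure \<rho> \<theta> x)"

definition P_vec :: "'a measure \<Rightarrow> ('a \<Rightarrow> real) \<Rightarrow> real \<Rightarrow> real \<Rightarrow> real \<Rightarrow> real list" where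
  "P_vec M X1 \<rho> \<theta> x =
     [\<P>(\<omega> in M. X1 \<omega> < left_thr \<rho> \<theta> x),
      \<P>(\<omega> in M. left_thr \<rho> \<theta> x \<le> X1 \<omega> \<and> X1 \<omega> \<le> right_thr \<rho> \<theta> x),
      \<P>(\<omega> in M. right_thr \<rho> \<theta> x < X1 \<omega>)]"


section \<open>The scheme\<close>

text \<open>Bin \<open>0\<close> is \<open>J\<^sub>0\<close>; bins \<open>1, \<dots>, N\<close> partition \<open>J\<^sub>1\<close> and bins \<open>-1, \<dots>, -N\<close> partition
  \<open>J\<^sub>-\<^sub>1\<close>, both numbered outwards from \<open>J\<^sub>0\<close>. Every bin is half-open like \<open>J\<^sub>0\<close> and \<open>J\<^sub>\<plusminus>\<^sub>1\<close>.\<close>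

definition bin_lo :: "real \<Rightarrow> real \<Rightarrow> nat \<Rightarrow> int \<Rightarrow> real" where
  "bin_lo \<rho> \<theta> N k =
     (if k = 0 then tau_m1 \<rho> \<theta>
      else if k > 0 then tau1 \<rho> \<theta> + (of_int k - 1) * (H1 \<rho> \<theta> / real N)
      else tau_m1 \<rho> \<theta> + of_int k * (H1 \<rho> \<theta> / real N))"

definition bin_hi :: "real \<Rightarrow> real \<Rightarrow> nat \<Rightarrow> int \<Rightarrow> real" where
  "bin_hi \<rho> \<theta> N k =
     (if k = 0 then tau1 \<rho> \<theta>
      else if k > 0 then tau1 \<rho> \<theta> + of_int k * (H1 \<rho> \<theta> / real N)
      else tau_m1 \<rho> \<theta> + (of_int k + 1) * (H1 \<rho> \<theta> / real N))"

definition bin :: "real \<Rightarrow> real \<Rightarrow> nat \<Rightarrow> int \<Rightarrow> real set" where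
  "bin \<rho> \<theta> N k = {bin_lo \<rho> \<theta> N k<..bin_hi \<rho> \<theta> N k}"

definition bin_mid :: "real \<Rightarrow> real \<Rightarrow> nat \<Rightarrow> int \<Rightarrow> real" where
  "bin_mid \<rho> \<theta> N k = (bin_lo \<rho> \<theta> N k + bin_hi \<rho> \<theta> N k) / 2"

text \<open>Outside the support \<open>(-H/2, H/2]\<close> of \<open>X\<^sub>2\<close> the index is an unspecified constant; this
  concerns a null event only.\<close>

definition msg2 :: "real \<Rightarrow> real \<Rightarrow> nat \<Rightarrow> real \<Rightarrow> int" where
  "msg2 \<rho> \<theta> N x2 = (THE k. k \<in> {- int N..int N} \<and> x2 \<in> bin \<rho> \<theta> N k)"

definition msg1 :: "real \<Rightarrow> real \<Rightarrow> nat \<Rightarrow> int \<Rightarrow> real \<Rightarrow> int" where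
  "msg1 \<rho> \<theta> N k x1 =
     (if x1 < left_thr \<rho> \<theta> (bin_mid \<rho> \<theta> N k) then -1
      else if x1 > right_thr \<rho> \<theta> (bin_mid \<rho> \<theta> N k) then 1
      else 0)"

definition U2 :: "real \<Rightarrow> real \<Rightarrow> ('a \<Rightarrow> real) \<Rightarrow> nat \<Rightarrow> 'a \<Rightarrow> int" where
  "U2 \<rho> \<theta> X2 N \<omega> = msg2 \<rho> \<theta> N (X2 \<omega>)"

definition U1 :: "real \<Rightarrow> real \<Rightarrow> ('a \<Rightarrow> real) \<Rightarrow> ('a \<Rightarrow> real) \<Rightarrow> nat \<Rightarrow> 'a \<Rightarrow> int" where
  "U1 \<rho> \<theta> X1 X2 N \<omega> = msg1 \<rho> \<theta> N (U2 \<rho> \<theta> X2 N \<omega>) (X1 \<omega>)"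

definition rectangle :: "real \<Rightarrow> real \<Rightarrow> nat \<Rightarrow> int \<Rightarrow> int \<Rightarrow> (real \<times> real) set" where
  "rectangle \<rho> \<theta> N k j =
     {x \<in> babai_cell \<rho> \<theta>. snd x \<in> bin \<rho> \<theta> N k \<and> msg1 \<rho> \<theta> N k (fst x) = j}"

text \<open>Ties between maximizers may be broken in any way.\<close>

definition decision_rule :: "real \<Rightarrow> real \<Rightarrow> nat \<Rightarrow> (int \<Rightarrow> int \<Rightarrow> real \<times> real) \<Rightarrow> bool" where
  "decision_rule \<rho> \<theta> N d \<longleftrightarrow>
     (\<forall>k\<in>{- int N..int N}. \<forall>j\<in>{-1, 0, 1}.
        is_arg_max (\<lambda>v. measure lborel (rectangle \<rho> \<theta> N k j \<inter> voronoi \<rho> \<theta> v))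
          (\<lambda>v. v \<in> lambda_lattice \<rho> \<theta>) (d k j))"

text \<open>The decision is correct iff it is a closest lattice point to \<open>X\<close>, i.e. iff \<open>X\<close> lies in its
  Voronoi cell; points with several closest lattice points form a null set.\<close>

definition error_prob ::
  "'a measure \<Rightarrow> ('a \<Rightarrow> real) \<Rightarrow> ('a \<Rightarrow> real) \<Rightarrow> real \<Rightarrow> real \<Rightarrow> (int \<Rightarrow> int \<Rightarrow> real \<times> real) \<Rightarrow> nat \<Rightarrow> real"
  where
  "error_prob M X1 X2 \<rho> \<theta> d N =
     \<P>(\<omega> in M. (X1 \<omega>, X2 \<omega>) \<notin> voronoi \<rho> \<theta> (d (U2 \<rho> \<theta> X2 N \<omega>) (U1 \<rho> \<theta> X1 X2 N \<omega>)))"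

definition reply_bits ::
  "'a measure \<Rightarrow> ('a \<Rightarrow> real) \<Rightarrow> ('a \<Rightarrow> real) \<Rightarrow> real \<Rightarrow> real \<Rightarrow> nat \<Rightarrow> real" where
  "reply_bits M X1 X2 \<rho> \<theta> N =
     prob_space.rv_cond_entropy M (U1 \<rho> \<theta> X1 X2 N) (U2 \<rho> \<theta> X2 N)"

definition total_bits ::
  "'a measure \<Rightarrow> ('a \<Rightarrow> real) \<Rightarrow> ('a \<Rightarrow> real) \<Rightarrow> real \<Rightarrow> real \<Rightarrow> nat \<Rightarrow> real" where
  "total_bits M X1 X2 \<rho> \<theta> N =
     prob_space.rv_entropy M (U2 \<rho> \<theta> X2 N) + reply_bits M X1 X2 \<rho> \<theta> N"

definition kappa ::
  "'a measure \<Rightarrow> ('a \<Rightarrow> real) \<Rightarrow> ('a \<Rightarrow> real) \<Rightarrow> real \<Rightarrow> real \<Rightarrow> real" where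
  "kappa M X1 X2 \<rho> \<theta> = lim (\<lambda>N. reply_bits M X1 X2 \<rho> \<theta> N)"

end

(* A horizontal line at height y meets the Voronoi cell of 0 inside the Babai cell in an interval whose
   endpoints move linearly in y once |y| exceeds tau_1. Hence in an outer bin of height H_1/N the only
   misdecided points form wedges between a vertical threshold, placed for the bin's midpoint, and a
   slanted Voronoi wall; their areas are quadratic in the bin height and sum to beta H / N. Each
   wedge covers less than half of its rectangle, so the maximizing lattice point is forced.
   Given U_2, the reply has entropy H(P(m)) at the bin midpoint m, so H(U_1 | U_2) is a midpoint
   Riemann sum of a continuous function. The term H(U_2) is explicit, and 2^(R/(1-Q_0)) contains the
   factor N that cancels the one in P_e = beta/N. *)

theory Submission
  imports Defs "HOL-Real_Asymp.Real_Asymp"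
begin


section \<open>Midpoint sums, closest lattice points and wedge areas\<close>

text \<open>Reflecting the second coordinate exchanges the shift a = \<rho> cos \<theta> of the
  lattice with 1 - a, so the geometry is stated for a parameter b with b(1 - b) = a(1 - a) and
  serves both halves of the cell. Since H_1 = a(1 - a)/(2H) depends only on this product, both
  halves share the critical height tau_1, and the horizontal rates of the two walls always add up to
  H/b + H/(1 - b) = 1/(2 H_1). This makes beta exact at every N. In an outer bin, replies 1 and -1
  err in the half next to the central strip and reply 0 errs in the other half. Both halves have
  total rate 1/(2 H_1) and height H_1/(2N), so each contributes H_1/(16 N^2). The 2N outer bins give
  H_1/(4N), to be divided by H, and 2 L_2 + L_1 = 1/2 identifies the constant. What shapes many
  statements is the bookkeeping at edges: half-open cells and bins, shared Voronoi boundaries, and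
  messages outside the support. These concern only null sets, but thresholds and messages can be
  unspecified there.\<close>

lemma riemann_midpoint_sums:
  fixes g :: "real \<Rightarrow> real"
  assumes "u < v" and cont: "continuous_on {u..v} g"
  shows "(\<lambda>N. (v - u) / real N * (\<Sum>i<N. g (u + (real i + 1/2) * ((v - u) / real N))))
    \<longlonglongrightarrow> integral {u..v} g"
proof (rule LIMSEQ_I)
  fix e :: real assume "e > 0"
  define e' where "e' = e / (2 * (v - u))"
  have "e' > 0" using \<open>e > 0\<close> \<open>u < v\<close> by (simp add: e'_def)
  \<comment> \<open>With an antiderivative, the integral over a piece is exactly a value of
    \<open>g\<close> times the length of the piece, so only the variation of \<open>g\<close>
    between that point and the midpoint has to be estimated.\<close>
  obtain G where G: "\<And>x. x \<in> {u..v} \<Longrightarrow> (G has_vector_derivative g x) (at x within {u..v})"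
    using antiderivative_continuous[OF cont] by blast
  have int: "integral {u..v} g = G v - G u"
    using fundamental_theorem_of_calculus[of u v G g] G \<open>u < v\<close> by (simp add: integral_unique)
  have "uniformly_continuous_on {u..v} g"
    using cont by (simp add: compact_uniformly_continuous)
  then obtain r where "r > 0" and r: "\<And>x y. x \<in> {u..v} \<Longrightarrow> y \<in> {u..v} \<Longrightarrow> dist y x < r \<Longrightarrow> dist (g y) (g x) < e'"
    using \<open>e' > 0\<close> unfolding uniformly_continuous_on_def by metis
  obtain N0 :: nat where N0: "(v - u) / r < real N0" using reals_Archimedean2 by blast
  show "\<exists>no. \<forall>n\<ge>no. norm ((v - u) / real n * (\<Sum>i<n. g (u + (real i + 1/2) * ((v - u) / real n))) - integral {u..v} g) < e"
  proof (intro exI[of _ "max N0 1"] allI impI)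
    fix n :: nat assume n: "max N0 1 \<le> n"
    define w where "w = (v - u) / real n"
    have "n > 0" using n by simp
    have "w > 0" using \<open>n > 0\<close> \<open>u < v\<close> by (simp add: w_def)
    have nw: "real n * w = v - u" using \<open>n > 0\<close> by (simp add: w_def)
    have "(v - u) / r < real n" using N0 n by linarith
    then have "w < r" using \<open>r > 0\<close> \<open>n > 0\<close> by (simp add: w_def field_simps)
    define p where "p i = u + real i * w" for i :: nat
    have "\<bar>w * g (u + (real i + 1/2) * w) - (G (p (Suc i)) - G (p i))\<bar> \<le> w * e'" if "i < n" for i
    proof -
      have "real (Suc i) * w \<le> real n * w" using that \<open>w > 0\<close> by (intro mult_right_mono) auto
      then have up: "p (Suc i) \<le> v" using nw by (simp add: p_def)
      have lo: "u \<le> p i" using \<open>w > 0\<close> by (simp add: p_def)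
      have step: "p (Suc i) = p i + w" by (simp add: p_def algebra_simps)
      have "(G has_derivative (\<lambda>h. h *\<^sub>R g x)) (at x within {p i..p (Suc i)})"
        if "x \<in> {p i..p (Suc i)}" for x
        using G[of x] that lo up
        by (auto simp: has_vector_derivative_def intro: has_derivative_subset)
      then obtain z where z: "z \<in> {p i<..<p (Suc i)}" "G (p (Suc i)) - G (p i) = (p (Suc i) - p i) *\<^sub>R g z"
        using mvt_simple[of "p i" "p (Suc i)" G "\<lambda>x h. h *\<^sub>R g x"] step \<open>w > 0\<close> by auto
      define m where "m = u + (real i + 1/2) * w"
      have m: "m = p i + w / 2" by (simp add: m_def p_def algebra_simps)
      have "dist m z < r" using z(1) step m \<open>w < r\<close> by (auto simp: dist_real_def abs_if)
      then have "\<bar>g m - g z\<bar> \<le> e'"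
        using r[of z m] z(1) step m lo up \<open>w > 0\<close> by (auto simp: dist_real_def)
      then have "w * \<bar>g m - g z\<bar> \<le> w * e'" using \<open>w > 0\<close> by simp
      moreover have "w * g m - (G (p (Suc i)) - G (p i)) = w * (g m - g z)"
        using z(2) step by (simp add: algebra_simps)
      ultimately show ?thesis using \<open>w > 0\<close> by (simp add: abs_mult m_def)
    qed
    note bound = this
    have tel: "(\<Sum>i<n. G (p (Suc i)) - G (p i)) = G v - G u"
      by (subst sum_lessThan_telescope) (simp add: p_def nw)
    from bound have "\<bar>\<Sum>i<n. w * g (u + (real i + 1/2) * w) - (G (p (Suc i)) - G (p i))\<bar> \<le> (\<Sum>i<n. w * e')"
      by (intro order_trans[OF sum_abs] sum_mono) auto
    also have "\<dots> = (v - u) * e'" using nw by (simp add: mult.assoc[symmetric])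
    also have "\<dots> = e / 2" using \<open>u < v\<close> by (simp add: e'_def divide_simps)
    also have "(\<Sum>i<n. w * g (u + (real i + 1/2) * w) - (G (p (Suc i)) - G (p i)))
        = w * (\<Sum>i<n. g (u + (real i + 1/2) * w)) - (G v - G u)"
      by (subst sum_subtractf) (simp only: tel sum_distrib_left)
    finally show "norm ((v - u) / real n * (\<Sum>i<n. g (u + (real i + 1/2) * ((v - u) / real n))) - integral {u..v} g) < e"
      using \<open>e > 0\<close> by (simp add: int w_def)
  qed
qed

section \<open>Closest lattice points in coordinates\<close>

lemma nearest_in_two_rows:
  fixes a h x y :: real and i j :: int
  assumes "0 < a" "a < 1" "h > 0" "3/4 \<le> h\<^sup>2" "\<bar>x\<bar> \<le> 1/2" "0 \<le> y" "y \<le> h/2"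
  defines "D \<equiv> (x - (of_int i + of_int j * a))\<^sup>2 + (y - of_int j * h)\<^sup>2"
  shows "x\<^sup>2 + y\<^sup>2 \<le> D \<or> (x - a)\<^sup>2 + (y - h)\<^sup>2 \<le> D \<or> (x - (a - 1))\<^sup>2 + (y - h)\<^sup>2 \<le> D"
proof -
  have x2: "x\<^sup>2 \<le> 1/4" using abs_le_square_iff[of x "1/2"] assms by (simp add: power2_eq_square)
  consider "j = 0" | "j = 1" | "j \<le> -1" | "j \<ge> 2" by linarith
  then show ?thesis
  proof cases
    case 1
    have "\<bar>x\<bar> \<le> \<bar>x - of_int i\<bar>"
    proof (cases "i = 0")
      case False
      then have "\<bar>real_of_int i\<bar> \<ge> 1" by linarith
      then show ?thesis using assms(5) by linarith
    qed simp
    then have "x\<^sup>2 \<le> (x - of_int i)\<^sup>2" by (simp add: abs_le_square_iff)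
    then show ?thesis using 1 by (simp add: D_def)
  next
    case 2
    \<comment> \<open>The bisector between neighbouring points of row 1 is vertical. Those beyond
      \<open>a\<close> and beyond \<open>a - 1\<close> run at a + 1/2 and a - 3/2, outside |x| \<le>
      1/2.\<close>
    consider "i = 0" | "i = -1" | "i \<ge> 1" | "i \<le> -2" by linarith
    then show ?thesis
    proof cases
      case 3
      then have "\<bar>x - a\<bar> \<le> \<bar>x - (of_int i + a)\<bar>" using assms by linarith
      then have "(x - a)\<^sup>2 \<le> (x - (of_int i + a))\<^sup>2" by (simp add: abs_le_square_iff)
      then show ?thesis using 2 by (simp add: D_def)
    next
      case 4
      then have "\<bar>x - (a - 1)\<bar> \<le> \<bar>x - (of_int i + a)\<bar>" using assms by linarith
      then have "(x - (a - 1))\<^sup>2 \<le> (x - (of_int i + a))\<^sup>2" by (simp add: abs_le_square_iff)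
      then show ?thesis using 2 by (simp add: D_def)
    qed (use 2 in \<open>simp_all add: D_def algebra_simps\<close>)
  next
    \<comment> \<open>In every row other than 0 and 1 the vertical distance alone beats the distance
      to the origin, because x^2 \<le> 1/4 < h^2.\<close>
    case 3
    then have "of_int j * h \<le> - 1 * h" using assms by (intro mult_right_mono) auto
    then have "\<bar>y + h\<bar> \<le> \<bar>y - of_int j * h\<bar>" using assms by linarith
    then have "(y + h)\<^sup>2 \<le> (y - of_int j * h)\<^sup>2" by (simp add: abs_le_square_iff)
    moreover have "y\<^sup>2 + h\<^sup>2 \<le> (y + h)\<^sup>2" using assms by (simp add: power2_sum)
    ultimately have "x\<^sup>2 + y\<^sup>2 \<le> D"
      using x2 assms(4) zero_le_power2[of "x - (of_int i + of_int j * a)"] unfolding D_def by linarith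
    then show ?thesis by blast
  next
    case 4
    then have "2 * h \<le> of_int j * h" using assms by (intro mult_right_mono) auto
    then have "\<bar>3/2 * h\<bar> \<le> \<bar>y - of_int j * h\<bar>" using assms by linarith
    then have "(3/2 * h)\<^sup>2 \<le> (y - of_int j * h)\<^sup>2" by (simp only: abs_le_square_iff)
    then have "9/4 * h\<^sup>2 \<le> (y - of_int j * h)\<^sup>2" by (simp add: power2_eq_square)
    moreover have "y\<^sup>2 \<le> (h/2)\<^sup>2" using assms by (intro power_mono) auto
    then have "y\<^sup>2 \<le> 1/4 * h\<^sup>2" by (simp add: power2_eq_square)
    ultimately have "x\<^sup>2 + y\<^sup>2 \<le> D"
      using x2 assms(4) zero_le_power2[of "x - (of_int i + of_int j * a)"] unfolding D_def by linarith
    then show ?thesis by blast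
  qed
qed

text \<open>Voronoi membership for an arbitrary shift \<open>a\<close>, so that the reflected
  lattice with shift \<open>1 - a\<close> is covered too.\<close>

definition nearest :: "real \<Rightarrow> real \<Rightarrow> real \<Rightarrow> real \<Rightarrow> real \<Rightarrow> real \<Rightarrow> bool" where
  "nearest a h x y p q \<longleftrightarrow> (\<forall>i j :: int.
     (x - p)\<^sup>2 + (y - q)\<^sup>2 \<le> (x - (of_int i + of_int j * a))\<^sup>2 + (y - of_int j * h)\<^sup>2)"

text \<open>The reflection sends row \<open>j\<close> to row \<open>-j\<close>, which has shift
  \<open>- a\<close>; the index change from \<open>i\<close> to \<open>i + j\<close> adds an integer
  to it and makes it \<open>1 - a\<close>.\<close>

lemma nearest_reflect: "nearest a h x y p q \<longleftrightarrow> nearest (1 - a) h x (- y) p (- q)"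
proof -
  have *: "nearest (1 - a) h x (- y) p (- q)" if "nearest a h x y p q" for a y q
    unfolding nearest_def
  proof (intro allI)
    fix i j :: int
    have "(x - p)\<^sup>2 + (y - q)\<^sup>2 \<le> (x - (of_int (i + j) + of_int (-j) * a))\<^sup>2 + (y - of_int (-j) * h)\<^sup>2"
      using that unfolding nearest_def by blast
    moreover have "x - (of_int (i + j) + of_int (-j) * a) = x - (of_int i + of_int j * (1 - a))"
      by (simp add: algebra_simps)
    moreover have "(y - of_int (-j) * h)\<^sup>2 = (- y - of_int j * h)\<^sup>2" "(y - q)\<^sup>2 = (- y - - q)\<^sup>2"
      by (simp_all add: power2_eq_square algebra_simps)
    ultimately show "(x - p)\<^sup>2 + (- y - - q)\<^sup>2 \<le> (x - (of_int i + of_int j * (1 - a)))\<^sup>2 + (- y - of_int j * h)\<^sup>2"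
      by metis
  qed
  show ?thesis using *[of a y q] *[of "1 - a" "- y" "- q"] by auto
qed

text \<open>The bisectors of \<open>0\<close> and \<open>(a, h)\<close>, resp. \<open>(a - 1, h)\<close>, meet the vertical sides of the Babai
  cell at the common height \<open>h/2 - a(1 - a)/(2h)\<close>, which is \<open>\<tau>\<^sub>1\<close>.\<close>

lemma nearest_upper:
  fixes a h x y :: real
  assumes "0 < a" "a < 1" "h > 0" "3/4 \<le> h\<^sup>2" "\<bar>x\<bar> \<le> 1/2" "0 \<le> y" "y \<le> h/2"
  defines "t \<equiv> h/2 - a * (1 - a) / (2 * h)"
  shows nearest_upper_0: "nearest a h x y 0 0 \<longleftrightarrow>
      - (1/2) + h / (1 - a) * (y - t) \<le> x \<and> x \<le> 1/2 - h / a * (y - t)"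
    and nearest_upper_right: "nearest a h x y a h \<longleftrightarrow> 1/2 - h / a * (y - t) \<le> x"
    and nearest_upper_left: "nearest a h x y (a - 1) h \<longleftrightarrow> x \<le> - (1/2) + h / (1 - a) * (y - t)"
proof -
  have iff: "nearest a h x y p q \<longleftrightarrow> (x - p)\<^sup>2 + (y - q)\<^sup>2 \<le> x\<^sup>2 + y\<^sup>2 \<and>
    (x - p)\<^sup>2 + (y - q)\<^sup>2 \<le> (x - a)\<^sup>2 + (y - h)\<^sup>2 \<and>
    (x - p)\<^sup>2 + (y - q)\<^sup>2 \<le> (x - (a - 1))\<^sup>2 + (y - h)\<^sup>2" (is "_ \<longleftrightarrow> ?R") for p q
  proof
    assume *: "nearest a h x y p q"
    show ?R
      using *[unfolded nearest_def, rule_format, of 0 0] *[unfolded nearest_def, rule_format, of 0 1]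
        *[unfolded nearest_def, rule_format, of "-1" 1] by simp
  next
    assume ?R
    then show "nearest a h x y p q"
      unfolding nearest_def using nearest_in_two_rows[OF assms(1-7)] by (meson order_trans)
  qed
  have r: "1/2 - h / a * (y - t) = (a\<^sup>2 + h\<^sup>2 - 2 * h * y) / (2 * a)"
    using assms(1,3) by (simp add: t_def field_simps power2_eq_square)
  have l: "- (1/2) + h / (1 - a) * (y - t) = - (((1 - a)\<^sup>2 + h\<^sup>2 - 2 * h * y) / (2 * (1 - a)))"
    using assms(2,3) by (simp add: t_def field_simps power2_eq_square)
  have A: "x\<^sup>2 + y\<^sup>2 \<le> (x - a)\<^sup>2 + (y - h)\<^sup>2 \<longleftrightarrow> x \<le> 1/2 - h / a * (y - t)"
    "(x - a)\<^sup>2 + (y - h)\<^sup>2 \<le> x\<^sup>2 + y\<^sup>2 \<longleftrightarrow> 1/2 - h / a * (y - t) \<le> x"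
    unfolding r using assms(1) by (simp_all add: field_simps power2_eq_square)
  have B: "x\<^sup>2 + y\<^sup>2 \<le> (x - (a - 1))\<^sup>2 + (y - h)\<^sup>2 \<longleftrightarrow> - (1/2) + h / (1 - a) * (y - t) \<le> x"
    "(x - (a - 1))\<^sup>2 + (y - h)\<^sup>2 \<le> x\<^sup>2 + y\<^sup>2 \<longleftrightarrow> x \<le> - (1/2) + h / (1 - a) * (y - t)"
    unfolding l using assms(2) by (simp_all add: field_simps power2_eq_square)
  \<comment> \<open>The two upper neighbours are separated by the vertical line x = a - 1/2. Up to
    height h/2 this line stays between the two walls (\<open>L\<close> and \<open>R\<close> below),
    so comparing either neighbour with the origin also settles the comparison between the
    two.\<close>
  have C: "(x - a)\<^sup>2 + (y - h)\<^sup>2 \<le> (x - (a - 1))\<^sup>2 + (y - h)\<^sup>2 \<longleftrightarrow> a - 1/2 \<le> x"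
    "(x - (a - 1))\<^sup>2 + (y - h)\<^sup>2 \<le> (x - a)\<^sup>2 + (y - h)\<^sup>2 \<longleftrightarrow> x \<le> a - 1/2"
    by (simp_all add: field_simps power2_eq_square)
  have yt: "y - t \<le> a * (1 - a) / (2 * h)" using assms(7) by (simp add: t_def)
  have "h / a * (y - t) \<le> h / a * (a * (1 - a) / (2 * h))"
    using assms(1,3) by (intro mult_left_mono[OF yt]) simp
  also have "\<dots> = (1 - a) / 2" using assms(1,3) by simp
  also have "\<dots> \<le> 1 - a" using assms(2) by simp
  finally have R: "a - 1/2 \<le> 1/2 - h / a * (y - t)" by (simp only: le_diff_eq)
  have "h / (1 - a) * (y - t) \<le> h / (1 - a) * (a * (1 - a) / (2 * h))"
    using assms(2,3) by (intro mult_left_mono[OF yt]) simp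
  also have "\<dots> = a / 2" using assms(2,3) by simp
  also have "\<dots> \<le> a" using assms(1) by simp
  finally have L: "- (1/2) + h / (1 - a) * (y - t) \<le> a - 1/2" by (simp del: times_divide_eq_left)
  show "nearest a h x y 0 0 \<longleftrightarrow>
      - (1/2) + h / (1 - a) * (y - t) \<le> x \<and> x \<le> 1/2 - h / a * (y - t)"
    using iff[of 0 0] A B by auto
  show "nearest a h x y a h \<longleftrightarrow> 1/2 - h / a * (y - t) \<le> x"
    using iff[of a h] A C R by auto
  show "nearest a h x y (a - 1) h \<longleftrightarrow> x \<le> - (1/2) + h / (1 - a) * (y - t)"
    using iff[of "a - 1" h] B C L by auto
qed

text \<open>Only lengths of horizontal sections enter, so \<open>E\<close> may consist of two
  triangles with apexes at the same height \<open>m\<close>. Height \<open>p\<close> is exempt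
  because a half-open bin can omit its end.\<close>

lemma emeasure_wedge:
  fixes E :: "(real \<times> real) set" and c m p :: real
  assumes E: "E \<in> sets borel" and "c \<ge> 0"
    and sec: "\<And>y. y \<noteq> p \<Longrightarrow> emeasure lborel {x. (x, y) \<in> E} =
      ennreal (c * \<bar>y - m\<bar>) * indicator (closed_segment m p) y"
  shows "emeasure lborel E = ennreal (c * (p - m)\<^sup>2 / 2)"
proof -
  have "emeasure lborel E = emeasure (lborel \<Otimes>\<^sub>M lborel) E" by (simp add: lborel_prod)
  also have "\<dots> = (\<integral>\<^sup>+y. emeasure lborel ((\<lambda>x. (x, y)) -` E) \<partial>lborel)"
    using E by (intro lborel_pair.emeasure_pair_measure_alt2) (metis lborel_prod sets_lborel)
  also have "\<dots> = (\<integral>\<^sup>+y. ennreal (c * \<bar>y - m\<bar>) * indicator (closed_segment m p) y \<partial>lborel)"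
    by (intro nn_integral_cong_AE eventually_mono[OF AE_lborel_singleton[of p]])
      (simp add: vimage_def sec)
  also have "\<dots> = ennreal (c * (p - m)\<^sup>2 / 2)"
  proof (cases "m \<le> p")
    case True
    then have "(\<integral>\<^sup>+y. ennreal (c * \<bar>y - m\<bar>) * indicator (closed_segment m p) y \<partial>lborel)
      = (\<integral>\<^sup>+y. ennreal (c * (y - m)) * indicator {m..p} y \<partial>lborel)"
      by (intro nn_integral_cong) (auto simp: closed_segment_eq_real_ivl indicator_def)
    also have "\<dots> = ennreal (c * (p - m)\<^sup>2 / 2 - c * (m - m)\<^sup>2 / 2)"
      using True \<open>c \<ge> 0\<close> by (intro nn_integral_FTC_Icc) (auto intro!: derivative_eq_intros)
    finally show ?thesis by simp
  next
    case False
    then have "(\<integral>\<^sup>+y. ennreal (c * \<bar>y - m\<bar>) * indicator (closed_segment m p) y \<partial>lborel)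
      = (\<integral>\<^sup>+y. ennreal (c * (m - y)) * indicator {p..m} y \<partial>lborel)"
      by (intro nn_integral_cong) (auto simp: closed_segment_eq_real_ivl indicator_def)
    also have "\<dots> = ennreal (c * (m * m - m\<^sup>2 / 2) - c * (m * p - p\<^sup>2 / 2))"
      using False \<open>c \<ge> 0\<close> by (intro nn_integral_FTC_Icc) (auto intro!: derivative_eq_intros)
    also have "c * (m * m - m\<^sup>2 / 2) - c * (m * p - p\<^sup>2 / 2) = c * (p - m)\<^sup>2 / 2"
      by (simp add: power2_eq_square field_simps)
    finally show ?thesis .
  qed
  finally show ?thesis .
qed

section \<open>The Voronoi cell inside the Babai cell\<close>

locale hexagonal_cell =
  fixes \<rho> \<theta> :: real
  assumes rho: "\<rho> \<ge> 1" and theta: "0 < \<theta>" "\<theta> < pi / 2"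
    and shift: "0 < \<rho> * cos \<theta>" "\<rho> * cos \<theta> < 1 / 2"
begin

definition a :: real where "a = \<rho> * cos \<theta>"
definition h :: real where "h = cell_height \<rho> \<theta>"
definition \<eta> :: real where "\<eta> = H1 \<rho> \<theta>"
definition \<tau> :: real where "\<tau> = tau1 \<rho> \<theta>"

lemma a: "0 < a" "a < 1/2"
  using shift by (simp_all add: a_def)

lemma h_pos: "0 < h"
  using rho theta sin_gt_zero[of \<theta>] by (simp add: h_def cell_height_def)

text \<open>The second generator has length \<rho> \<ge> 1 and horizontal part below 1/2, which
  keeps the rows apart.\<close>

lemma h_sq: "3/4 \<le> h\<^sup>2"
proof -
  have "a\<^sup>2 + h\<^sup>2 = \<rho>\<^sup>2"
    by (simp add: a_def h_def cell_height_def power_mult_distrib distrib_left[symmetric])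
  moreover have "1 \<le> \<rho>\<^sup>2" using rho by simp
  moreover have "a\<^sup>2 \<le> (1/2)\<^sup>2" using a by (intro power_mono) auto
  ultimately show ?thesis by (simp add: power2_eq_square)
qed

lemma eta_eq: "\<eta> = a * (1 - a) / (2 * h)"
proof -
  have "sin \<theta> \<noteq> 0" "\<rho> \<noteq> 0" using h_pos by (auto simp: h_def cell_height_def)
  then show ?thesis by (simp add: \<eta>_def H1_def a_def h_def cell_height_def)
qed

lemma eta_pos: "0 < \<eta>"
  using a h_pos by (simp add: eta_eq)

lemma tau_eq: "\<tau> = h/2 - a * (1 - a) / (2 * h)"
  using eta_eq by (simp add: \<tau>_def tau1_def h_def \<eta>_def)

lemma tau_eta: "\<tau> + \<eta> = h/2"
  by (simp add: tau_eq eta_eq)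

lemma tau_pos: "0 < \<tau>"
proof -
  have "a * (1 - a) \<le> 1/4" using zero_le_power2[of "a - 1/2"] by (simp add: power2_eq_square algebra_simps)
  also have "\<dots> < h\<^sup>2" using h_sq by simp
  finally show ?thesis using h_pos by (simp add: tau_eq field_simps power2_eq_square)
qed

lemma tau_m1_eq: "tau_m1 \<rho> \<theta> = - \<tau>"
  by (simp add: tau_m1_def \<tau>_def)

text \<open>At height \<open>y\<close> the lattice points competing with the origin are
  \<open>(side y, offs y)\<close> and \<open>(side y - 1, offs y)\<close>, both in the adjacent
  row.\<close>

definition side :: "real \<Rightarrow> real" where "side y = (if y \<ge> 0 then a else 1 - a)"
definition offs :: "real \<Rightarrow> real" where "offs y = (if y \<ge> 0 then h else - h)"

text \<open>Reflecting \<open>x\<^sub>2\<close> turns the lattice into the one with \<open>a\<close> replaced by \<open>1 - a\<close>, hence the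
  parameter \<open>b = side x\<^sub>2\<close>: the walls of the Voronoi cell at height \<open>x\<^sub>2\<close> are \<open>wall b \<bar>x\<^sub>2\<bar>\<close> and
  \<open>- wall (1 - b) \<bar>x\<^sub>2\<bar>\<close>.\<close>

definition wall :: "real \<Rightarrow> real \<Rightarrow> real" where "wall b y = 1/2 - h / b * (y - \<tau>)"

lemma side: "0 < side y" "side y < 1"
  using a by (auto simp: side_def)

lemma lattice_iff: "w \<in> lambda_lattice \<rho> \<theta> \<longleftrightarrow> (\<exists>i j :: int. w = (of_int i + of_int j * a, of_int j * h))"
  by (auto simp: lambda_lattice_def a_def h_def cell_height_def)

lemma voronoi_iff_nearest: "(x, y) \<in> voronoi \<rho> \<theta> (p, q) \<longleftrightarrow> nearest a h x y p q"
  by (simp add: voronoi_def nearest_def lattice_iff Ball_def dist_Pair_Pair dist_real_def)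
    (metis (no_types))

context
  fixes x y :: real
  assumes x: "\<bar>x\<bar> \<le> 1/2" and y: "\<bar>y\<bar> \<le> h/2"
begin

lemma
  shows voronoi_0_iff: "(x, y) \<in> voronoi \<rho> \<theta> (0, 0) \<longleftrightarrow>
      - wall (1 - side y) \<bar>y\<bar> \<le> x \<and> x \<le> wall (side y) \<bar>y\<bar>"
    and voronoi_right_iff: "(x, y) \<in> voronoi \<rho> \<theta> (side y, offs y) \<longleftrightarrow> wall (side y) \<bar>y\<bar> \<le> x"
    and voronoi_left_iff: "(x, y) \<in> voronoi \<rho> \<theta> (side y - 1, offs y) \<longleftrightarrow> x \<le> - wall (1 - side y) \<bar>y\<bar>"
proof -
  \<comment> \<open>The critical height is invariant under exchanging \<open>a\<close> and
    \<open>1 - a\<close>.\<close>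
  have t: "h/2 - (1 - a) * (1 - (1 - a)) / (2 * h) = \<tau>" by (simp add: tau_eq mult.commute)
  note up = nearest_upper[OF _ _ h_pos h_sq x]
  show "(x, y) \<in> voronoi \<rho> \<theta> (0, 0) \<longleftrightarrow>
      - wall (1 - side y) \<bar>y\<bar> \<le> x \<and> x \<le> wall (side y) \<bar>y\<bar>"
    using up(1)[of a y] up(1)[of "1 - a" "- y"] a y t nearest_reflect[of a h x y 0 0]
    unfolding voronoi_iff_nearest wall_def side_def tau_eq[symmetric] by (auto simp: abs_if)
  show "(x, y) \<in> voronoi \<rho> \<theta> (side y, offs y) \<longleftrightarrow> wall (side y) \<bar>y\<bar> \<le> x"
    using up(2)[of a y] up(2)[of "1 - a" "- y"] a y t nearest_reflect[of a h x y "1 - a" "- h"]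
    unfolding voronoi_iff_nearest wall_def side_def offs_def tau_eq[symmetric] by (auto simp: abs_if)
  show "(x, y) \<in> voronoi \<rho> \<theta> (side y - 1, offs y) \<longleftrightarrow> x \<le> - wall (1 - side y) \<bar>y\<bar>"
    using up(3)[of a y] up(3)[of "1 - a" "- y"] a y t nearest_reflect[of a h x y "- a" "- h"]
    unfolding voronoi_iff_nearest wall_def side_def offs_def tau_eq[symmetric] by (auto simp: abs_if)
qed

end

lemma neighbours_in_lattice:
  "(0, 0) \<in> lambda_lattice \<rho> \<theta>" "(side y, offs y) \<in> lambda_lattice \<rho> \<theta>"
  "(side y - 1, offs y) \<in> lambda_lattice \<rho> \<theta>"
proof -
  show "(0, 0) \<in> lambda_lattice \<rho> \<theta>" unfolding lattice_iff by (intro exI[of _ 0]) simp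
  show "(side y, offs y) \<in> lambda_lattice \<rho> \<theta>"
    unfolding lattice_iff side_def offs_def
    by (intro exI[of _ "if y \<ge> 0 then 0 else 1"] exI[of _ "if y \<ge> 0 then 1 else -1"]) simp
  show "(side y - 1, offs y) \<in> lambda_lattice \<rho> \<theta>"
    unfolding lattice_iff side_def offs_def
    by (intro exI[of _ "if y \<ge> 0 then -1 else 0"] exI[of _ "if y \<ge> 0 then 1 else -1"]) simp
qed

lemma babai_iff: "(x, y) \<in> babai_cell \<rho> \<theta> \<longleftrightarrow> - (1/2) < x \<and> x \<le> 1/2 \<and> - (h/2) < y \<and> y \<le> h/2"
  by (auto simp: babai_cell_def h_def cell_height_def)

lemma babai_Times: "babai_cell \<rho> \<theta> = {- (1/2)<..1/2} \<times> {- (h/2)<..h/2}"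
  by (auto simp: babai_iff)

lemma side_prod: "side y * (1 - side y) = a * (1 - a)"
  by (simp add: side_def)

text \<open>The wall moves inwards with growing height, and at height h/2 it passes through (b/2,
  h/2), the midpoint between the origin and its neighbour (b, h).\<close>

lemma wall_lower:
  assumes "0 < b" "b * (1 - b) = a * (1 - a)" "y \<le> h/2"
  shows "b / 2 \<le> wall b y"
proof -
  have "h / b * (y - \<tau>) \<le> h / b * \<eta>"
    using assms h_pos tau_eta by (intro mult_left_mono) auto
  also have "\<dots> = (1 - b) / 2" using h_pos assms(1) by (simp add: eta_eq assms(2)[symmetric])
  also have "\<dots> = 1/2 - b/2" by (simp add: diff_divide_distrib)
  finally show ?thesis unfolding wall_def by (simp only: le_diff_eq add.commute)
qed

lemma wall_upper_iff:
  assumes "0 < b" shows "wall b y \<le> 1/2 \<longleftrightarrow> \<tau> \<le> y"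
proof -
  have "0 < h / b" using assms h_pos by simp
  then have "0 \<le> h / b * (y - \<tau>) \<longleftrightarrow> \<tau> \<le> y" by (simp only: zero_le_mult_iff) auto
  then show ?thesis unfolding wall_def by linarith
qed

text \<open>The two bounds add up to 1/2: the walls never come closer than that, which later keeps
  the rectangle of reply 0 wide enough.\<close>

lemma wall_lower_side:
  assumes "y \<le> h/2" shows "side z / 2 \<le> wall (side z) y" "1/2 - side z / 2 \<le> wall (1 - side z) y"
  using wall_lower[of "side z" y] wall_lower[of "1 - side z" y] side[of z] side_prod[of z] assms
  by (auto simp: mult.commute diff_divide_distrib)

lemma wall_diff: "wall b y - wall b y' = h / b * (y' - y)"
  by (simp add: wall_def algebra_simps diff_divide_distrib)

end

section \<open>Thresholds and bins\<close>

context hexagonal_cell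
begin

text \<open>In the central strip the walls lie on or beyond the vertical sides, hence the clipping
  at -1/2 and 1/2. The closure restores the edge -1/2 that the half-open cell omits. At height
  \<open>- (h/2)\<close> the section would be empty and its \<open>Inf\<close> and
  \<open>Sup\<close> meaningless, so that height is excluded.\<close>

lemma thresholds:
  assumes "- (h/2) < y" "y \<le> h/2"
  shows left_thr_eq: "left_thr \<rho> \<theta> y = max (- (1/2)) (- wall (1 - side y) \<bar>y\<bar>)"
    and right_thr_eq: "right_thr \<rho> \<theta> y = min (1/2) (wall (side y) \<bar>y\<bar>)"
proof -
  let ?l = "- wall (1 - side y) \<bar>y\<bar>" and ?r = "wall (side y) \<bar>y\<bar>"
  have ab: "\<bar>y\<bar> \<le> h/2" using assms by auto
  have sec: "{x. (x, y) \<in> babai_cell \<rho> \<theta> \<inter> voronoi \<rho> \<theta> (0, 0)} = {- (1/2)<..1/2} \<inter> {?l..?r}"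
    using voronoi_0_iff[OF _ ab] assms by (auto simp: babai_iff)
  note s = side[of y]
  have "left_thr \<rho> \<theta> y = max (- (1/2)) ?l \<and> right_thr \<rho> \<theta> y = min (1/2) ?r"
  proof (cases "\<bar>y\<bar> \<le> \<tau>")
    case True
    then have "?l \<le> - (1/2)" "1/2 \<le> ?r"
      using wall_upper_iff[of "side y" "\<bar>y\<bar>"] wall_upper_iff[of "1 - side y" "\<bar>y\<bar>"] s h_pos
      unfolding wall_def by (auto simp: mult_nonneg_nonpos divide_nonpos_pos)
    then have "section_closure \<rho> \<theta> y = {- (1/2)..1/2}"
      unfolding section_closure_def sec
      by (subst Int_absorb2) auto
    then show ?thesis using \<open>?l \<le> - (1/2)\<close> \<open>1/2 \<le> ?r\<close> by (simp add: left_thr_def right_thr_def)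
  next
    case False
    then have "- (1/2) < ?l" "?r < 1/2"
      using s h_pos unfolding wall_def by (auto simp: zero_less_mult_iff divide_pos_pos)
    moreover have "- v \<le> u" if "b/2 \<le> u" "1/2 - b/2 \<le> v" for b u v :: real
      using that by linarith
    from this[OF wall_lower_side[OF ab]] have "?l \<le> ?r" .
    moreover have "section_closure \<rho> \<theta> y = {?l..?r}"
      unfolding section_closure_def sec using calculation
      by (subst Int_absorb1) auto
    ultimately show ?thesis by (simp add: left_thr_def right_thr_def)
  qed
  then show "left_thr \<rho> \<theta> y = max (- (1/2)) ?l" "right_thr \<rho> \<theta> y = min (1/2) ?r" by auto
qed

lemma thr_order:
  assumes "- (h/2) < y" "y \<le> h/2"
  shows "- (1/2) \<le> left_thr \<rho> \<theta> y" "left_thr \<rho> \<theta> y \<le> right_thr \<rho> \<theta> y" "right_thr \<rho> \<theta> y \<le> 1/2"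
    "1/2 \<le> right_thr \<rho> \<theta> y - left_thr \<rho> \<theta> y"
proof -
  have "\<bar>y\<bar> \<le> h/2" using assms by auto
  then show "- (1/2) \<le> left_thr \<rho> \<theta> y" "left_thr \<rho> \<theta> y \<le> right_thr \<rho> \<theta> y" "right_thr \<rho> \<theta> y \<le> 1/2"
    "1/2 \<le> right_thr \<rho> \<theta> y - left_thr \<rho> \<theta> y"
    unfolding thresholds[OF assms]
    using wall_lower_side[of "\<bar>y\<bar>" y] side[of y] by (auto simp: min_def max_def)
qed

lemma thr_outside:
  assumes "- (h/2) < y" "y \<le> h/2" "\<tau> \<le> \<bar>y\<bar>"
  shows left_thr_outside: "left_thr \<rho> \<theta> y = - wall (1 - side y) \<bar>y\<bar>"
    and right_thr_outside: "right_thr \<rho> \<theta> y = wall (side y) \<bar>y\<bar>"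
  using thresholds[OF assms(1,2)] side[of y] assms(3) wall_upper_iff[of "1 - side y" "\<bar>y\<bar>"]
    wall_upper_iff[of "side y" "\<bar>y\<bar>"] by auto

lemma thr_inside:
  assumes "\<bar>y\<bar> < \<tau>"
  shows "left_thr \<rho> \<theta> y = - (1/2)" "right_thr \<rho> \<theta> y = 1/2"
  using thresholds[of y] side[of y] assms wall_upper_iff[of "1 - side y" "\<bar>y\<bar>"]
    wall_upper_iff[of "side y" "\<bar>y\<bar>"] tau_eta eta_pos by (auto simp: min_def max_def)

end

section \<open>Geometry of the bins\<close>

locale binning = hexagonal_cell +
  fixes N :: nat
  assumes N: "N \<ge> 1"
begin

definition \<delta> :: real where "\<delta> = \<eta> / real N"

abbreviation lo :: "int \<Rightarrow> real" where "lo \<equiv> bin_lo \<rho> \<theta> N"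
abbreviation hi :: "int \<Rightarrow> real" where "hi \<equiv> bin_hi \<rho> \<theta> N"
abbreviation mid :: "int \<Rightarrow> real" where "mid \<equiv> bin_mid \<rho> \<theta> N"
abbreviation bins :: "int set" where "bins \<equiv> {- int N..int N}"

lemma delta_pos: "0 < \<delta>" using eta_pos N by (simp add: \<delta>_def)

lemma N_delta: "real N * \<delta> = \<eta>" using N by (simp add: \<delta>_def)

lemma lo_eq: "lo k = (if k \<le> 0 then - \<tau> + of_int k * \<delta> else \<tau> + (of_int k - 1) * \<delta>)"
  by (simp add: bin_lo_def tau_m1_eq \<tau>_def[symmetric] \<delta>_def \<eta>_def)

lemma hi_eq: "hi k = (if k < 0 then - \<tau> + (of_int k + 1) * \<delta> else \<tau> + of_int k * \<delta>)"
  by (simp add: bin_hi_def tau_m1_eq \<tau>_def[symmetric] \<delta>_def \<eta>_def)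

text \<open>Thus the bins are the gaps of one increasing sequence \<open>lo\<close> from -h/2 to
  h/2; disjointness and covering both rest on this.\<close>

lemma hi_lo_Suc: "hi k = lo (k + 1)"
  by (auto simp: hi_eq lo_eq)

lemma bin_length: "hi k - lo k = (if k = 0 then 2 * \<tau> else \<delta>)"
  by (auto simp: hi_eq lo_eq algebra_simps)

lemma lo_less_hi: "lo k < hi k"
  using bin_length[of k] tau_pos delta_pos by (auto split: if_splits)

lemma lo_mono: "k \<le> l \<Longrightarrow> lo k \<le> lo l"
proof (induction l rule: int_ge_induct)
  case (step i)
  then show ?case using lo_less_hi[of i] hi_lo_Suc[of i] by simp
qed simp

lemma lo_first: "lo (- int N) = - (h/2)"
  using N N_delta tau_eta by (simp add: lo_eq)

lemma hi_last: "hi (int N) = h/2"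
  using N N_delta tau_eta by (simp add: hi_eq)

lemma bin_eq: "bin \<rho> \<theta> N k = {lo k<..hi k}"
  by (simp add: bin_def)

lemma bin_bounds:
  assumes "k \<in> bins" shows "- (h/2) \<le> lo k" "hi k \<le> h/2"
  using lo_mono[of "- int N" k] lo_mono[of "k + 1" "int N + 1"] assms lo_first hi_last
    hi_lo_Suc[of k] hi_lo_Suc[of "int N"] by auto

lemma bin_disjoint:
  assumes "y \<in> bin \<rho> \<theta> N k" "y \<in> bin \<rho> \<theta> N l" shows "k = l"
proof (rule ccontr)
  assume "k \<noteq> l"
  then have "hi k \<le> lo l \<or> hi l \<le> lo k"
    using lo_mono[of "k + 1" l] lo_mono[of "l + 1" k] hi_lo_Suc by force
  then show False using assms by (auto simp: bin_eq)
qed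

lemma bin_exists:
  assumes "- (h/2) < y" "y \<le> h/2" shows "\<exists>k\<in>bins. y \<in> bin \<rho> \<theta> N k"
proof -
  define K where "K = {k \<in> bins. lo k < y}"
  have "finite K" unfolding K_def by (rule finite_subset[of _ bins]) auto
  moreover have "- int N \<in> K" using assms lo_first by (auto simp: K_def)
  ultimately have M: "Max K \<in> K" "\<And>k. k \<in> K \<Longrightarrow> k \<le> Max K" using Max_in by auto
  have "y \<le> hi (Max K)"
  proof (cases "Max K = int N")
    case False
    then have "Max K + 1 \<in> bins" using M(1) by (auto simp: K_def)
    moreover have "Max K + 1 \<notin> K" using M(2)[of "Max K + 1"] by linarith
    ultimately have "\<not> lo (Max K + 1) < y" unfolding K_def by blast
    then show ?thesis by (simp add: hi_lo_Suc)
  qed (use assms hi_last in simp)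
  then show ?thesis using M(1) by (auto simp: K_def bin_eq)
qed

lemma msg2_iff:
  assumes "- (h/2) < y" "y \<le> h/2"
  shows "msg2 \<rho> \<theta> N y = k \<longleftrightarrow> k \<in> bins \<and> y \<in> bin \<rho> \<theta> N k"
proof -
  have "\<exists>!k. k \<in> bins \<and> y \<in> bin \<rho> \<theta> N k"
    using bin_exists[OF assms] bin_disjoint by blast
  from theI'[OF this] bin_disjoint show ?thesis unfolding msg2_def by blast
qed

lemma mid_bounds:
  assumes "k \<in> bins" shows "- (h/2) < mid k" "mid k \<le> h/2" "lo k < mid k" "mid k < hi k"
  using bin_bounds[OF assms] lo_less_hi[of k] by (auto simp: bin_mid_def)

lemma mid_0: "mid 0 = 0"
  by (simp add: bin_mid_def lo_eq hi_eq)

lemma mid_eq: "k \<noteq> 0 \<Longrightarrow> mid k = sgn (of_int k) * (\<tau> + (\<bar>of_int k\<bar> - 1/2) * \<delta>)"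
  by (auto simp: bin_mid_def lo_eq hi_eq field_simps sgn_if)

lemma abs_mid_eq: "k \<noteq> 0 \<Longrightarrow> \<bar>mid k\<bar> = \<tau> + (\<bar>of_int k\<bar> - 1/2) * \<delta>"
proof -
  assume "k \<noteq> 0"
  moreover from this have "(1/2) * \<delta> \<le> (\<bar>of_int k\<bar> - 1/2) * \<delta>"
    using delta_pos by (intro mult_right_mono) auto
  ultimately show ?thesis using tau_pos delta_pos by (auto simp: mid_eq abs_mult sgn_if)
qed

text \<open>The ends of an outer bin nearer to and farther from the central strip; naming them this
  way treats bins \<open>k\<close> and \<open>- k\<close> together.\<close>

definition inner :: "int \<Rightarrow> real" where "inner k = (if k > 0 then lo k else hi k)"
definition outer :: "int \<Rightarrow> real" where "outer k = (if k > 0 then hi k else lo k)"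

text \<open>An outer bin lies on one side of the axis, so one pair of neighbours competes throughout
  and heights can be compared through absolute values. Its two halves are the segments from the
  midpoint to \<open>inner k\<close> and \<open>outer k\<close>; the end points are exempt since the
  bin omits its lower end.\<close>

lemma bin_outer:
  assumes "k \<noteq> 0" "k \<in> bins"
  shows "\<tau> < \<bar>mid k\<bar>" "\<delta>/2 \<le> \<bar>mid k\<bar> - \<tau>"
    "(inner k - mid k)\<^sup>2 = (\<delta>/2)\<^sup>2" "(outer k - mid k)\<^sup>2 = (\<delta>/2)\<^sup>2"
    "y \<in> bin \<rho> \<theta> N k \<Longrightarrow> \<tau> \<le> \<bar>y\<bar> \<and> \<bar>y\<bar> \<le> h/2 \<and> side y = side (mid k) \<and> offs y = offs (mid k)
       \<and> \<bar>\<bar>y\<bar> - \<bar>mid k\<bar>\<bar> = \<bar>y - mid k\<bar>"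
    "y \<noteq> inner k \<Longrightarrow> y \<in> closed_segment (mid k) (inner k) \<longleftrightarrow> y \<in> bin \<rho> \<theta> N k \<and> \<bar>y\<bar> \<le> \<bar>mid k\<bar>"
    "y \<noteq> outer k \<Longrightarrow> y \<in> closed_segment (mid k) (outer k) \<longleftrightarrow> y \<in> bin \<rho> \<theta> N k \<and> \<bar>mid k\<bar> \<le> \<bar>y\<bar>"
proof -
  show 1: "\<delta>/2 \<le> \<bar>mid k\<bar> - \<tau>"
  proof -
    have "(1/2) * \<delta> \<le> (\<bar>of_int k\<bar> - 1/2) * \<delta>"
      using delta_pos assms(1) by (intro mult_right_mono) auto
    then show ?thesis using abs_mid_eq[OF assms(1)] by simp
  qed
  then show "\<tau> < \<bar>mid k\<bar>" using delta_pos by simp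
  note m = mid_bounds[OF assms(2)] bin_bounds[OF assms(2)]
  have len: "mid k - lo k = \<delta>/2" "hi k - mid k = \<delta>/2"
    using bin_length[of k] assms(1) by (auto simp: bin_mid_def field_simps)
  then show "(inner k - mid k)\<^sup>2 = (\<delta>/2)\<^sup>2" "(outer k - mid k)\<^sup>2 = (\<delta>/2)\<^sup>2"
    unfolding inner_def outer_def by (metis power2_commute)+
  have pos: "k > 0 \<Longrightarrow> \<tau> \<le> lo k" "k < 0 \<Longrightarrow> hi k \<le> - \<tau>"
  proof -
    assume "k > 0"
    then show "\<tau> \<le> lo k" using delta_pos by (simp add: lo_eq)
  next
    assume "k < 0"
    then have "(of_int k + 1) * \<delta> \<le> 0" using delta_pos by (intro mult_nonpos_nonneg) auto
    then show "hi k \<le> - \<tau>" using \<open>k < 0\<close> by (simp add: hi_eq)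
  qed
  consider "k > 0" | "k < 0" using assms(1) by linarith
  note cs = this
  show "\<tau> \<le> \<bar>y\<bar> \<and> \<bar>y\<bar> \<le> h/2 \<and> side y = side (mid k) \<and> offs y = offs (mid k)
       \<and> \<bar>\<bar>y\<bar> - \<bar>mid k\<bar>\<bar> = \<bar>y - mid k\<bar>" if "y \<in> bin \<rho> \<theta> N k"
    using cs
  proof cases
    case 1
    then have "0 < y" "0 < mid k" "\<tau> \<le> y" using pos m that tau_pos by (auto simp: bin_eq)
    then show ?thesis using m that by (auto simp: bin_eq side_def offs_def)
  next
    case 2
    then have "y < 0" "mid k < 0" "y \<le> - \<tau>" using pos m that tau_pos by (auto simp: bin_eq)
    then show ?thesis using m that by (auto simp: bin_eq side_def offs_def)
  qed
  show "y \<in> closed_segment (mid k) (inner k) \<longleftrightarrow> y \<in> bin \<rho> \<theta> N k \<and> \<bar>y\<bar> \<le> \<bar>mid k\<bar>"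
    if "y \<noteq> inner k"
    using cs
  proof cases
    case 1
    then have "0 < lo k" "0 < mid k" using pos m tau_pos by auto
    then show ?thesis using m that 1 by (auto simp: bin_eq closed_segment_eq_real_ivl inner_def)
  next
    case 2
    then have "hi k < 0" "mid k < 0" using pos m tau_pos by auto
    then show ?thesis using m that 2 by (auto simp: bin_eq closed_segment_eq_real_ivl inner_def)
  qed
  show "y \<in> closed_segment (mid k) (outer k) \<longleftrightarrow> y \<in> bin \<rho> \<theta> N k \<and> \<bar>mid k\<bar> \<le> \<bar>y\<bar>"
    if "y \<noteq> outer k"
    using cs
  proof cases
    case 1
    then have "0 < lo k" "0 < mid k" using pos m tau_pos by auto
    then show ?thesis using m that 1 by (auto simp: bin_eq closed_segment_eq_real_ivl outer_def)
  next
    case 2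
    then have "hi k < 0" "mid k < 0" using pos m tau_pos by auto
    then show ?thesis using m that 2 by (auto simp: bin_eq closed_segment_eq_real_ivl outer_def)
  qed
qed

end

section \<open>Misdecided wedges\<close>

lemma closed_voronoi: "closed (voronoi \<rho> \<theta> v)"
proof -
  have "voronoi \<rho> \<theta> v = (\<Inter>w\<in>lambda_lattice \<rho> \<theta>. {x. dist x v \<le> dist x w})"
    by (auto simp: voronoi_def)
  moreover have "closed {x :: real \<times> real. dist x v \<le> dist x w}" for w
    by (intro closed_Collect_le continuous_intros)
  ultimately show ?thesis by auto
qed

lemma borel_voronoi [measurable]: "voronoi \<rho> \<theta> v \<in> sets borel"
  using closed_voronoi by (rule borel_closed)

text \<open>A common point is equidistant from \<open>v\<close> and \<open>w\<close> and hence lies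
  on their bisector.\<close>

lemma voronoi_overlap_null:
  assumes "v \<in> lambda_lattice \<rho> \<theta>" "w \<in> lambda_lattice \<rho> \<theta>" "v \<noteq> w"
  shows "voronoi \<rho> \<theta> v \<inter> voronoi \<rho> \<theta> w \<in> null_sets lborel"
proof -
  have "voronoi \<rho> \<theta> v \<inter> voronoi \<rho> \<theta> w \<subseteq> {x. (w - v) \<bullet> x = ((norm w)\<^sup>2 - (norm v)\<^sup>2) / 2}"
  proof
    fix x assume "x \<in> voronoi \<rho> \<theta> v \<inter> voronoi \<rho> \<theta> w"
    then have "norm (x - v) = norm (x - w)" using assms by (force simp: voronoi_def dist_norm)
    then have "(x - v) \<bullet> (x - v) = (x - w) \<bullet> (x - w)" by (simp add: norm_eq)
    then show "x \<in> {x. (w - v) \<bullet> x = ((norm w)\<^sup>2 - (norm v)\<^sup>2) / 2}"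
      by (simp add: power2_norm_eq_inner inner_diff_left inner_diff_right inner_commute field_simps)
  qed
  then have "negligible (voronoi \<rho> \<theta> v \<inter> voronoi \<rho> \<theta> w)"
    using assms(3) by (intro negligible_subset[OF negligible_hyperplane[of "w - v" "((norm w)\<^sup>2 - (norm v)\<^sup>2) / 2"]]) simp_all
  moreover have "voronoi \<rho> \<theta> v \<inter> voronoi \<rho> \<theta> w \<in> sets lborel" by simp
  ultimately show ?thesis
    by (simp only: negligible_iff_null_sets null_sets_completion_iff)
qed

text \<open>Up to a null set, any other lattice point can only get what \<open>v\<close> leaves over
  in \<open>R\<close>. So the area left over by \<open>v\<close> suffices, no other cell has to be
  measured, and no tie can occur.\<close>

lemma majority_decision:
  assumes R: "R \<in> sets lborel" "emeasure lborel R < \<infinity>"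
    and v: "v \<in> lambda_lattice \<rho> \<theta>"
    and less: "2 * measure lborel (R - voronoi \<rho> \<theta> v) < measure lborel R"
    and w: "is_arg_max (\<lambda>v. measure lborel (R \<inter> voronoi \<rho> \<theta> v)) (\<lambda>v. v \<in> lambda_lattice \<rho> \<theta>) w"
  shows "w = v"
proof (rule ccontr)
  assume "w \<noteq> v"
  let ?V = "voronoi \<rho> \<theta>"
  have "R \<in> fmeasurable lborel"
    using R by (rule fmeasurableI)
  note fin = fmeasurableI2[OF this]
  have wL: "w \<in> lambda_lattice \<rho> \<theta>" and "measure lborel (R \<inter> ?V v) \<le> measure lborel (R \<inter> ?V w)"
    using w v by (simp_all only: is_arg_max_def) (meson not_less)+
  moreover have "measure lborel (R \<inter> ?V w) = measure lborel (R \<inter> ?V w - ?V v \<inter> ?V w)"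
    using voronoi_overlap_null[OF v wL] \<open>w \<noteq> v\<close> R by (subst measure_Diff_null_set) auto
  moreover have "\<dots> \<le> measure lborel (R - ?V v)"
    using R by (intro measure_mono_fmeasurable fin) auto
  moreover have "measure lborel (R \<inter> ?V v \<union> (R - ?V v)) = measure lborel (R \<inter> ?V v) + measure lborel (R - ?V v)"
  proof -
    have "R \<inter> ?V v \<in> fmeasurable lborel" "R - ?V v \<in> fmeasurable lborel"
      using R by (auto intro!: fin)
    moreover have "R - ?V v - R \<inter> ?V v = R - ?V v" by auto
    ultimately show ?thesis by (metis measure_Un2)
  qed
  then have "measure lborel R = measure lborel (R \<inter> ?V v) + measure lborel (R - ?V v)"
    by (simp only: Int_Diff_Un)
  ultimately show False using less by simp
qed

section \<open>Error areas and forced decisions\<close>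

context binning
begin

text \<open>For \<open>k = 0\<close> and \<open>j\<close> nonzero the rectangle is empty and every
  lattice point maximizes; \<open>(0, 0)\<close> is a placeholder there.\<close>

definition target :: "int \<Rightarrow> int \<Rightarrow> real \<times> real" where
  "target k j = (if k = 0 \<or> j = 0 then (0, 0)
     else if j = 1 then (side (mid k), offs (mid k)) else (side (mid k) - 1, offs (mid k)))"

text \<open>Rate at which the misdecided part of a horizontal section grows with the distance from
  the bin midpoint. Reply 0 errs at both walls, hence the sum.\<close>

definition slope :: "int \<Rightarrow> int \<Rightarrow> real" where
  "slope k j = (if k = 0 then 0 else if j = 1 then h / side (mid k)
     else if j = -1 then h / (1 - side (mid k)) else h / side (mid k) + h / (1 - side (mid k)))"

text \<open>Since the cell has length 1, this is also the conditional probability of reply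
  \<open>j\<close> given bin \<open>k\<close>.\<close>

definition width :: "int \<Rightarrow> int \<Rightarrow> real" where
  "width k j = (if j = 1 then 1/2 - right_thr \<rho> \<theta> (mid k)
     else if j = -1 then left_thr \<rho> \<theta> (mid k) + 1/2
     else right_thr \<rho> \<theta> (mid k) - left_thr \<rho> \<theta> (mid k))"

lemma slope_nonneg: "0 \<le> slope k j"
  using side[of "mid k"] h_pos by (auto simp: slope_def)

text \<open>Here 1/b + 1/(1 - b) = 1/(b(1 - b)), and this product is the same for b = a and b = 1 -
  a, so the sign of \<open>k\<close> does not matter.\<close>

lemma slope_sum: "k \<noteq> 0 \<Longrightarrow> slope k 0 = 1 / (2 * \<eta>)"
proof -
  have "h / b + h / (1 - b) = 1 / (2 * \<eta>)" if "0 < b" "b < 1" "b * (1 - b) = a * (1 - a)" for b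
  proof -
    have "1 / (2 * \<eta>) = h / (b * (1 - b))" by (simp add: eta_eq that(3))
    then show ?thesis using that by (simp add: field_simps)
  qed
  then show "k \<noteq> 0 \<Longrightarrow> slope k 0 = 1 / (2 * \<eta>)" using side[of "mid k"] side_prod by (simp add: slope_def)
qed

lemma slope_split: "slope k 1 + slope k (-1) = slope k 0"
  by (simp add: slope_def)

lemma rectangle_eq:
  assumes "k \<in> bins"
  shows "rectangle \<rho> \<theta> N k j = (if j = 1 then {right_thr \<rho> \<theta> (mid k)<..1/2}
      else if j = -1 then {- (1/2)<..<left_thr \<rho> \<theta> (mid k)}
      else if j = 0 then {- (1/2)<..1/2} \<inter> {left_thr \<rho> \<theta> (mid k)..right_thr \<rho> \<theta> (mid k)} else {})
    \<times> bin \<rho> \<theta> N k"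
  using thr_order[OF mid_bounds(1,2)[OF assms]] bin_bounds[OF assms]
  by (auto simp: rectangle_def babai_iff msg1_def bin_eq)

lemma rectangle_borel: "k \<in> bins \<Longrightarrow> rectangle \<rho> \<theta> N k j \<in> sets borel"
  unfolding rectangle_eq bin_eq by (auto intro!: borel_Times)

lemma emeasure_Times_real:
  fixes A B :: "real set"
  assumes "A \<in> sets borel" "B \<in> sets borel"
  shows "emeasure lborel (A \<times> B) = emeasure lborel A * emeasure lborel B"
  using lborel.emeasure_pair_measure_Times[of A lborel B] assms by (simp add: lborel_prod)

lemma width_nonneg: "k \<in> bins \<Longrightarrow> 0 \<le> width k j"
  using thr_order[OF mid_bounds(1,2), of k] by (auto simp: width_def)

lemma emeasure_rectangle:
  assumes k: "k \<in> bins" and j: "j \<in> {-1, 0, 1}"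
  shows "emeasure lborel (rectangle \<rho> \<theta> N k j) = ennreal (width k j * (hi k - lo k))"
proof -
  note t = thr_order[OF mid_bounds(1,2)[OF k]]
  let ?l = "left_thr \<rho> \<theta> (mid k)" and ?r = "right_thr \<rho> \<theta> (mid k)"
  have "emeasure lborel ({- (1/2)<..1/2} \<inter> {?l..?r}) = emeasure lborel {?l..?r}"
  proof (rule antisym)
    show "emeasure lborel ({- (1/2)<..1/2} \<inter> {?l..?r}) \<le> emeasure lborel {?l..?r}"
      by (intro emeasure_mono) auto
    have "emeasure lborel {?l..?r} = emeasure lborel {?l<..?r}" using t by simp
    also have "\<dots> \<le> emeasure lborel ({- (1/2)<..1/2} \<inter> {?l..?r})"
      using t by (intro emeasure_mono) auto
    finally show "emeasure lborel {?l..?r} \<le> emeasure lborel ({- (1/2)<..1/2} \<inter> {?l..?r})" .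
  qed
  then show ?thesis
    using t j lo_less_hi[of k] unfolding rectangle_eq[OF k] bin_eq
    by (subst emeasure_Times_real) (auto simp: width_def ennreal_mult add.commute)
qed

lemma measure_rectangle:
  "k \<in> bins \<Longrightarrow> j \<in> {-1, 0, 1} \<Longrightarrow> measure lborel (rectangle \<rho> \<theta> N k j) = width k j * (hi k - lo k)"
  using emeasure_rectangle[of k j] width_nonneg[of k j] lo_less_hi[of k]
  by (simp add: measure_def)

text \<open>The central strip lies inside the cell of the origin, so bin 0 gives no error. In an
  outer bin, threshold and wall agree at the midpoint height and separate linearly: the error set is
  triangular with apex there, in the inner half for replies 1 and -1 and in the outer half for reply
  0. Each half has height \<open>\<delta>/2\<close>, whence the factor 1/8.\<close>

lemma emeasure_rectangle_wedge:
  assumes k: "k \<in> bins" and j: "j \<in> {-1, 0, 1}"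
  shows "emeasure lborel (rectangle \<rho> \<theta> N k j - voronoi \<rho> \<theta> (target k j)) = ennreal (slope k j * \<delta>\<^sup>2 / 8)"
proof (cases "k = 0")
  case True
  have "rectangle \<rho> \<theta> N k j - voronoi \<rho> \<theta> (target k j) = {}"
  proof (cases "j = 0")
    case j: False
    then show ?thesis
      using thr_inside[of 0] tau_pos True k by (auto simp: rectangle_eq mid_0)
  next
    case j: True
    show ?thesis
    proof (safe, goal_cases)
      case (1 x y)
      then have xy: "(x, y) \<in> babai_cell \<rho> \<theta>" "- \<tau> < y" "y \<le> \<tau>"
        using True by (auto simp: rectangle_def bin_eq lo_eq hi_eq)
      then have "1/2 \<le> wall (side y) \<bar>y\<bar>" "1/2 \<le> wall (1 - side y) \<bar>y\<bar>"
        using side[of y] h_pos by (auto simp: wall_def mult_nonneg_nonpos divide_nonpos_pos)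
      moreover have "\<bar>x\<bar> \<le> 1/2" "\<bar>y\<bar> \<le> h/2" using xy(1) by (auto simp: babai_iff)
      ultimately have "(x, y) \<in> voronoi \<rho> \<theta> (0, 0)" by (subst voronoi_0_iff) auto
      then show ?case using 1 True by (simp add: target_def)
    qed
  qed
  then have "emeasure lborel (rectangle \<rho> \<theta> N k j - voronoi \<rho> \<theta> (target k j)) = 0" by (simp only: emeasure_empty)
  then show ?thesis using True by (simp add: slope_def)
next
  case False
  note o = bin_outer[OF False k] and m = mid_bounds[OF k]
  let ?m = "mid k" and ?b = "side (mid k)"
  let ?E = "rectangle \<rho> \<theta> N k j - voronoi \<rho> \<theta> (target k j)"
  have am: "\<tau> \<le> \<bar>?m\<bar>" "\<bar>?m\<bar> \<le> h/2" using o(1) m by auto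
  note s = side[of ?m]
  have Eb: "?E \<in> sets borel" using rectangle_borel[OF k] by auto
  define WR where "WR z = wall ?b \<bar>z\<bar>" for z
  define WL where "WL z = wall (1 - ?b) \<bar>z\<bar>" for z
  note thr = thr_outside[OF m(1,2) am(1), folded WR_def WL_def]
  have bounds: "WR z \<le> 1/2" "WL z \<le> 1/2" "0 < WR z" "0 < WL z"
    if "z = ?m \<or> z \<in> bin \<rho> \<theta> N k" for z
  proof -
    have z: "\<tau> \<le> \<bar>z\<bar>" "\<bar>z\<bar> \<le> h/2" using that am o(5)[of z] by auto
    show "WR z \<le> 1/2" "WL z \<le> 1/2"
      using z s unfolding WR_def WL_def by (simp_all only: wall_upper_iff diff_gt_0_iff_gt)
    show "0 < WR z" "0 < WL z"
      using wall_lower_side[OF z(2), of ?m] s unfolding WR_def[symmetric] WL_def[symmetric]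
      by linarith+
  qed
  have hb: "0 < h / ?b" "0 < h / (1 - ?b)" using s h_pos by auto
  have diff: "WR z - WR z' = h / ?b * (\<bar>z'\<bar> - \<bar>z\<bar>)" "WL z - WL z' = h / (1 - ?b) * (\<bar>z'\<bar> - \<bar>z\<bar>)" for z z'
    unfolding WR_def WL_def by (rule wall_diff)+
  have mono: "WR z \<le> WR z' \<longleftrightarrow> \<bar>z'\<bar> \<le> \<bar>z\<bar>" "WL z \<le> WL z' \<longleftrightarrow> \<bar>z'\<bar> \<le> \<bar>z\<bar>" for z z'
  proof -
    have pos: "0 \<le> c * d \<longleftrightarrow> 0 \<le> d" if "0 < c" for c d :: real
      using that by (simp only: zero_le_mult_iff) auto
    have "WR z \<le> WR z' \<longleftrightarrow> 0 \<le> h / ?b * (\<bar>z\<bar> - \<bar>z'\<bar>)" "WL z \<le> WL z' \<longleftrightarrow> 0 \<le> h / (1 - ?b) * (\<bar>z\<bar> - \<bar>z'\<bar>)"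
      by (simp_all only: diff[symmetric] diff_ge_0_iff_ge)
    then show "WR z \<le> WR z' \<longleftrightarrow> \<bar>z'\<bar> \<le> \<bar>z\<bar>" "WL z \<le> WL z' \<longleftrightarrow> \<bar>z'\<bar> \<le> \<bar>z\<bar>"
      by (simp_all only: pos hb diff_ge_0_iff_ge)
  qed
  have vor: "(x, y) \<in> voronoi \<rho> \<theta> (0, 0) \<longleftrightarrow> - WL y \<le> x \<and> x \<le> WR y"
    "(x, y) \<in> voronoi \<rho> \<theta> (?b, offs ?m) \<longleftrightarrow> WR y \<le> x"
    "(x, y) \<in> voronoi \<rho> \<theta> (?b - 1, offs ?m) \<longleftrightarrow> x \<le> - WL y"
    if "\<bar>x\<bar> \<le> 1/2" "y \<in> bin \<rho> \<theta> N k" for x y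
    using voronoi_0_iff[OF that(1), of y] voronoi_right_iff[OF that(1), of y] voronoi_left_iff[OF that(1), of y]
      o(5)[OF that(2)] unfolding WR_def WL_def by auto
  have key: "emeasure lborel ?E = ennreal (slope k j * (p - ?m)\<^sup>2 / 2)"
    if "\<And>y. y \<noteq> p \<Longrightarrow> emeasure lborel {x. (x, y) \<in> ?E} = ennreal (slope k j * \<bar>y - ?m\<bar>) * indicator (closed_segment ?m p) y"
    for p
    using emeasure_wedge[OF Eb slope_nonneg that] .
  have fin: "slope k j * (\<delta>/2)\<^sup>2 / 2 = slope k j * \<delta>\<^sup>2 / 8" by (simp add: power_divide)
  consider "j = 1" | "j = -1" | "j = 0" using j by auto
  then show ?thesis
  proof cases
    case 1
    \<comment> \<open>Below the midpoint distance the wall lies to the right of the threshold, and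
      the gap between them still belongs to the origin. In the outer half this interval is
      empty.\<close>
    have sec: "{x. (x, y) \<in> ?E} = {WR ?m<..<WR y}" if y: "y \<in> bin \<rho> \<theta> N k" for y
    proof (intro set_eqI)
      fix x
      have "x \<in> {x. (x, y) \<in> ?E} \<longleftrightarrow> (WR ?m < x \<and> x \<le> 1/2) \<and> (x, y) \<notin> voronoi \<rho> \<theta> (?b, offs ?m)"
        using 1 False y by (simp add: rectangle_eq[OF k] thr target_def)
      also have "\<dots> \<longleftrightarrow> WR ?m < x \<and> x < WR y"
        using vor(2)[OF _ y, of x] bounds[of ?m] bounds[of y] y by auto
      finally show "x \<in> {x. (x, y) \<in> ?E} \<longleftrightarrow> x \<in> {WR ?m<..<WR y}" by simp
    qed
    have A: "emeasure lborel {x. (x, y) \<in> ?E} = ennreal (slope k j * \<bar>y - ?m\<bar>) * indicator (closed_segment ?m (inner k)) y"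
      if "y \<noteq> inner k" for y
    proof (cases "y \<in> bin \<rho> \<theta> N k")
      case y: True
      show ?thesis
      proof (cases "\<bar>y\<bar> \<le> \<bar>?m\<bar>")
        case True
        then have "\<bar>?m\<bar> - \<bar>y\<bar> = \<bar>y - ?m\<bar>" using o(5)[OF y] by linarith
        then show ?thesis unfolding sec[OF y] using True y o(6)[OF that] mono 1 False
          by (simp add: diff slope_def)
      next
        case False
        then show ?thesis unfolding sec[OF y] using y o(6)[OF that] mono by simp
      qed
    qed (use that o(6) in \<open>auto simp: rectangle_eq[OF k]\<close>)
    have "emeasure lborel ?E = ennreal (slope k j * (inner k - ?m)\<^sup>2 / 2)" by (intro key A)
    then show ?thesis by (simp only: o(3) fin)
  next
    case 2
    have sec: "{x. (x, y) \<in> ?E} = {- WL y<..<- WL ?m}" if y: "y \<in> bin \<rho> \<theta> N k" for y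
    proof (intro set_eqI)
      fix x
      have "x \<in> {x. (x, y) \<in> ?E} \<longleftrightarrow> (- (1/2) < x \<and> x < - WL ?m) \<and> (x, y) \<notin> voronoi \<rho> \<theta> (?b - 1, offs ?m)"
        using 2 False y by (simp add: rectangle_eq[OF k] thr target_def)
      also have "\<dots> \<longleftrightarrow> - WL y < x \<and> x < - WL ?m"
        using vor(3)[OF _ y, of x] bounds[of ?m] bounds[of y] y by auto
      finally show "x \<in> {x. (x, y) \<in> ?E} \<longleftrightarrow> x \<in> {- WL y<..<- WL ?m}" by simp
    qed
    have A: "emeasure lborel {x. (x, y) \<in> ?E} = ennreal (slope k j * \<bar>y - ?m\<bar>) * indicator (closed_segment ?m (inner k)) y"
      if "y \<noteq> inner k" for y
    proof (cases "y \<in> bin \<rho> \<theta> N k")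
      case y: True
      show ?thesis
      proof (cases "\<bar>y\<bar> \<le> \<bar>?m\<bar>")
        case True
        then have "\<bar>?m\<bar> - \<bar>y\<bar> = \<bar>y - ?m\<bar>" using o(5)[OF y] by linarith
        then show ?thesis unfolding sec[OF y] using True y o(6)[OF that] mono 2 False
          by (simp add: diff slope_def)
      next
        case False
        then show ?thesis unfolding sec[OF y] using y o(6)[OF that] mono by simp
      qed
    qed (use that o(6) in \<open>auto simp: rectangle_eq[OF k]\<close>)
    have "emeasure lborel ?E = ennreal (slope k j * (inner k - ?m)\<^sup>2 / 2)" by (intro key A)
    then show ?thesis by (simp only: o(3) fin)
  next
    case 3
    \<comment> \<open>In the outer half both walls have moved inwards past the thresholds, leaving
      one piece on each side. The removed point is the edge omitted by the half-open cell.\<close>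
    have sec: "{x. (x, y) \<in> ?E} = {- WL ?m..<- WL y} \<union> {WR y<..WR ?m} - {- (1/2)}"
      if y: "y \<in> bin \<rho> \<theta> N k" for y
    proof (intro set_eqI)
      fix x
      have "x \<in> {x. (x, y) \<in> ?E} \<longleftrightarrow>
          (- (1/2) < x \<and> x \<le> 1/2 \<and> - WL ?m \<le> x \<and> x \<le> WR ?m) \<and> (x, y) \<notin> voronoi \<rho> \<theta> (0, 0)"
        using 3 False y by (simp add: rectangle_eq[OF k] thr target_def)
      also have "\<dots> \<longleftrightarrow> x \<noteq> - (1/2) \<and> (- WL ?m \<le> x \<and> x < - WL y \<or> WR y < x \<and> x \<le> WR ?m)"
        using vor(1)[OF _ y, of x] bounds[of ?m] bounds[of y] y by (cases "\<bar>x\<bar> \<le> 1/2") auto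
      finally show "x \<in> {x. (x, y) \<in> ?E} \<longleftrightarrow> x \<in> {- WL ?m..<- WL y} \<union> {WR y<..WR ?m} - {- (1/2)}" by auto
    qed
    have A: "emeasure lborel {x. (x, y) \<in> ?E} = ennreal (slope k j * \<bar>y - ?m\<bar>) * indicator (closed_segment ?m (outer k)) y"
      if "y \<noteq> outer k" for y
    proof (cases "y \<in> bin \<rho> \<theta> N k")
      case y: True
      show ?thesis
      proof (cases "\<bar>?m\<bar> \<le> \<bar>y\<bar>")
        case True
        let ?A = "{- WL ?m..<- WL y}" and ?B = "{WR y<..WR ?m}"
        have d: "\<bar>y\<bar> - \<bar>?m\<bar> = \<bar>y - ?m\<bar>" using o(5)[OF y] True by linarith
        have "emeasure lborel {x. (x, y) \<in> ?E} = emeasure lborel (?A \<union> ?B)"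
          unfolding sec[OF y] by (rule emeasure_Diff_null_set) auto
        also have "\<dots> = emeasure lborel ?A + emeasure lborel ?B"
          using bounds[of y] y by (intro plus_emeasure[symmetric]) auto
        also have "\<dots> = ennreal (h / (1 - ?b) * \<bar>y - ?m\<bar>) + ennreal (h / ?b * \<bar>y - ?m\<bar>)"
          using mono True d by (simp add: diff)
        also have "\<dots> = ennreal (slope k j * \<bar>y - ?m\<bar>)"
        proof -
          have "0 \<le> h / (1 - ?b) * \<bar>y - ?m\<bar>" "0 \<le> h / ?b * \<bar>y - ?m\<bar>"
            using hb by (intro mult_nonneg_nonneg less_imp_le[OF hb(2)] less_imp_le[OF hb(1)] abs_ge_zero)+
          moreover have "slope k j = h / (1 - ?b) + h / ?b" using 3 \<open>k \<noteq> 0\<close> by (simp add: slope_def)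
          ultimately show ?thesis by (simp only: ennreal_plus[symmetric] distrib_right)
        qed
        finally show ?thesis using True y o(7)[OF that] by simp
      next
        case False
        then have empty: "{x. (x, y) \<in> ?E} = {}" using mono[of y ?m] mono[of ?m y]
          unfolding sec[OF y] by auto
        show ?thesis unfolding empty using y o(7)[OF that] False by simp
      qed
    qed (use that o(7) in \<open>auto simp: rectangle_eq[OF k]\<close>)
    have "emeasure lborel ?E = ennreal (slope k j * (outer k - ?m)\<^sup>2 / 2)" by (intro key A)
    then show ?thesis by (simp only: o(4) fin)
  qed
qed

text \<open>For replies 1 and -1 the tight case is the bin next to the strip, where the rectangle
  itself is thin: its width is \<open>slope k j * \<delta> / 2\<close>, so the wedge still fills
  only a quarter of it. For reply 0, \<open>slope k j * \<delta>\<close> is at most 1/2 while the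
  width is at least 1/2. Excluding the empty rectangles of bin 0 makes the strict inequality
  possible.\<close>

lemma wedge_less_half:
  assumes k: "k \<in> bins" and j: "j \<in> {-1, 0, 1}" and nz: "k \<noteq> 0 \<or> j = 0"
  shows "2 * (slope k j * \<delta>\<^sup>2 / 8) < width k j * (hi k - lo k)"
proof (cases "k = 0")
  case True
  then show ?thesis using nz thr_inside[of 0] tau_pos bin_length[of 0]
    by (simp add: slope_def width_def mid_0)
next
  case False
  note m = mid_bounds[OF k] and o = bin_outer[OF False k]
  have len: "hi k - lo k = \<delta>" using bin_length[of k] False by simp
  have thr: "left_thr \<rho> \<theta> (mid k) = - wall (1 - side (mid k)) \<bar>mid k\<bar>"
    "right_thr \<rho> \<theta> (mid k) = wall (side (mid k)) \<bar>mid k\<bar>"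
    using thr_outside[of "mid k"] m o(1) by auto
  have sq: "slope k j * \<delta>\<^sup>2 = (slope k j * \<delta>) * \<delta>" by (simp add: power2_eq_square)
  have "slope k j * \<delta> / 4 < width k j"
  proof (cases "j = 0")
    case j: True
    have "slope k j * \<delta> = 1 / (2 * real N)"
      using j slope_sum[OF False] N_delta eta_pos N by (simp add: \<delta>_def)
    also have "\<dots> \<le> 1/2" using N by (simp add: field_simps)
    finally show ?thesis using thr_order(4)[OF m(1,2)] j by (simp add: width_def)
  next
    case j': False
    then have pos: "0 < slope k j" using j False side[of "mid k"] h_pos by (auto simp: slope_def)
    have "width k j = slope k j * (\<bar>mid k\<bar> - \<tau>)"
      using j' j False by (auto simp: width_def slope_def thr wall_def)
    moreover have "slope k j * (\<delta> / 2) \<le> slope k j * (\<bar>mid k\<bar> - \<tau>)"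
      using pos o(2) by (intro mult_left_mono) auto
    moreover have "0 < slope k j * \<delta>" using pos delta_pos by simp
    ultimately show ?thesis by simp
  qed
  then have "slope k j * \<delta> / 4 * \<delta> < width k j * \<delta>" using delta_pos by simp
  then show ?thesis unfolding len sq by (simp add: ac_simps)
qed

lemma measure_wedge:
  assumes k: "k \<in> bins" and j: "j \<in> {-1, 0, 1}"
  shows "measure lborel (rectangle \<rho> \<theta> N k j - voronoi \<rho> \<theta> (target k j)) = slope k j * \<delta>\<^sup>2 / 8"
  using emeasure_rectangle_wedge[OF assms] slope_nonneg[of k j] by (simp add: measure_def)

lemma target_in_lattice: "target k j \<in> lambda_lattice \<rho> \<theta>"
  using neighbours_in_lattice by (simp add: target_def)

lemma decision_eq_target:
  assumes d: "decision_rule \<rho> \<theta> N d" and k: "k \<in> bins" and j: "j \<in> {-1, 0, 1}" and nz: "k \<noteq> 0 \<or> j = 0"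
  shows "d k j = target k j"
proof (rule majority_decision[where R = "rectangle \<rho> \<theta> N k j" and \<rho> = \<rho> and \<theta> = \<theta>])
  show "rectangle \<rho> \<theta> N k j \<in> sets lborel" using rectangle_borel[OF k] by simp
  show "emeasure lborel (rectangle \<rho> \<theta> N k j) < \<infinity>" by (simp add: emeasure_rectangle[OF k j])
  show "2 * measure lborel (rectangle \<rho> \<theta> N k j - voronoi \<rho> \<theta> (target k j)) < measure lborel (rectangle \<rho> \<theta> N k j)"
    using wedge_less_half[OF k j nz] by (simp only: measure_wedge[OF k j] measure_rectangle[OF k j])
  show "is_arg_max (\<lambda>v. measure lborel (rectangle \<rho> \<theta> N k j \<inter> voronoi \<rho> \<theta> v)) (\<lambda>v. v \<in> lambda_lattice \<rho> \<theta>) (d k j)"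
    using d k j unfolding decision_rule_def by blast
qed (rule target_in_lattice)

lemma measure_rectangle_error:
  assumes d: "decision_rule \<rho> \<theta> N d" and k: "k \<in> bins" and j: "j \<in> {-1, 0, 1}"
  shows "measure lborel (rectangle \<rho> \<theta> N k j - voronoi \<rho> \<theta> (d k j)) = slope k j * \<delta>\<^sup>2 / 8"
proof (cases "k \<noteq> 0 \<or> j = 0")
  case True
  then show ?thesis using measure_wedge[OF k j] decision_eq_target[OF d k j] by simp
next
  case False
  \<comment> \<open>Here the rule may pick any lattice point, but no point of the cell leads to
    these messages.\<close>
  then have "rectangle \<rho> \<theta> N k j = {}"
    using thr_inside[of 0] tau_pos k by (auto simp: rectangle_eq mid_0)
  then show ?thesis using False by (simp add: slope_def)
qed

section \<open>Measurability of the messages\<close>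

lemma msg1_range: "msg1 \<rho> \<theta> N k x \<in> {-1, 0, 1}"
  by (simp add: msg1_def)

lemma msg2_in: "k \<in> bins \<Longrightarrow> y \<in> bin \<rho> \<theta> N k \<Longrightarrow> msg2 \<rho> \<theta> N y = k"
  unfolding msg2_def using bin_disjoint by (intro the_equality) auto

lemma msg2_out: "\<not> (\<exists>k\<in>bins. y \<in> bin \<rho> \<theta> N k) \<Longrightarrow> msg2 \<rho> \<theta> N y = (THE k. False)"
  unfolding msg2_def by (intro arg_cong[of _ _ The] ext) blast

lemma measurable_msg2 [measurable]: "msg2 \<rho> \<theta> N \<in> measurable borel (count_space UNIV)"
proof -
  \<comment> \<open>The unspecified value outside the support may coincide with a genuine bin index,
    so the preimage formula must allow both parts at once.\<close>
  define c :: int where "c = (THE k. False)"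
  have "msg2 \<rho> \<theta> N -` {k} = (if k \<in> bins then bin \<rho> \<theta> N k else {}) \<union> (if k = c then - (\<Union>l\<in>bins. bin \<rho> \<theta> N l) else {})"
    (is "_ = ?S k") for k
  proof (rule set_eqI)
    fix y
    show "y \<in> msg2 \<rho> \<theta> N -` {k} \<longleftrightarrow> y \<in> ?S k"
    proof (cases "\<exists>l\<in>bins. y \<in> bin \<rho> \<theta> N l")
      case True
      then obtain l where l: "l \<in> bins" "y \<in> bin \<rho> \<theta> N l" by blast
      have "y \<in> bin \<rho> \<theta> N k \<longleftrightarrow> k = l" using l bin_disjoint by blast
      then show ?thesis unfolding vimage_singleton_eq msg2_in[OF l] using l by auto
    next
      case False
      then show ?thesis unfolding vimage_singleton_eq msg2_out[OF False] c_def[symmetric] by auto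
    qed
  qed
  moreover have "?S k \<in> sets borel" for k
    unfolding bin_eq by auto
  ultimately show ?thesis
    by (subst measurable_count_space_eq_countable) auto
qed

lemma measurable_msg1 [measurable]: "msg1 \<rho> \<theta> N k \<in> measurable borel (count_space UNIV)"
  unfolding msg1_def by measurable

lemma finite_msg2: "finite (range (msg2 \<rho> \<theta> N))"
proof -
  have "msg2 \<rho> \<theta> N y \<in> insert (THE k :: int. False) bins" for y
  proof (cases "\<exists>k\<in>bins. y \<in> bin \<rho> \<theta> N k")
    case True
    then obtain k where k: "k \<in> bins" "y \<in> bin \<rho> \<theta> N k" ..
    show ?thesis unfolding msg2_in[OF k] using k(1) by (rule insertI2)
  next
    case False
    show ?thesis unfolding msg2_out[OF False] by (rule insertI1)
  qed
  then have "range (msg2 \<rho> \<theta> N) \<subseteq> insert (THE k :: int. False) bins" by (rule image_subsetI)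
  then show ?thesis by (rule finite_subset) (intro finite.insertI finite_atLeastAtMost_int)
qed

lemma rectangle_iff: "(x, y) \<in> rectangle \<rho> \<theta> N k j \<longleftrightarrow>
    (x, y) \<in> babai_cell \<rho> \<theta> \<and> y \<in> bin \<rho> \<theta> N k \<and> msg1 \<rho> \<theta> N k x = j"
  by (simp add: rectangle_def)

end

section \<open>Probabilities as areas\<close>

locale uniform_source = binning + prob_space M for M :: "'a measure" +
  fixes X1 X2 :: "'a \<Rightarrow> real"
  assumes X1 [measurable]: "X1 \<in> borel_measurable M" and X2 [measurable]: "X2 \<in> borel_measurable M"
    and unif: "distr M lborel (\<lambda>\<omega>. (X1 \<omega>, X2 \<omega>)) = uniform_measure lborel (babai_cell \<rho> \<theta>)"
begin

lemma babai_borel: "babai_cell \<rho> \<theta> \<in> sets borel"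
  unfolding babai_Times by (intro borel_Times) auto

lemma emeasure_babai: "emeasure lborel (babai_cell \<rho> \<theta>) = ennreal h"
  unfolding babai_Times using h_pos by (subst emeasure_Times_real) auto

lemma prob_X:
  assumes E: "E \<in> sets borel"
  shows "prob {\<omega> \<in> space M. (X1 \<omega>, X2 \<omega>) \<in> E} = measure lborel (babai_cell \<rho> \<theta> \<inter> E) / h"
proof -
  have X: "(\<lambda>\<omega>. (X1 \<omega>, X2 \<omega>)) \<in> measurable M lborel" by simp
  have "emeasure M {\<omega> \<in> space M. (X1 \<omega>, X2 \<omega>) \<in> E} = emeasure (distr M lborel (\<lambda>\<omega>. (X1 \<omega>, X2 \<omega>))) E"
    using E by (subst emeasure_distr[OF X]) (auto intro!: arg_cong[of _ _ "emeasure M"])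
  also have "\<dots> = emeasure lborel (babai_cell \<rho> \<theta> \<inter> E) / emeasure lborel (babai_cell \<rho> \<theta>)"
    using E babai_borel unfolding unif by (subst emeasure_uniform_measure) auto
  also have "emeasure lborel (babai_cell \<rho> \<theta> \<inter> E) = ennreal (measure lborel (babai_cell \<rho> \<theta> \<inter> E))"
  proof (rule emeasure_eq_ennreal_measure)
    have "emeasure lborel (babai_cell \<rho> \<theta> \<inter> E) \<le> emeasure lborel (babai_cell \<rho> \<theta>)"
      using babai_borel by (intro emeasure_mono) auto
    then show "emeasure lborel (babai_cell \<rho> \<theta> \<inter> E) \<noteq> top" by (auto simp: emeasure_babai top_unique)
  qed
  finally show ?thesis using h_pos by (simp add: measure_def emeasure_babai divide_ennreal)
qed

end

section \<open>Entropies and probabilities of the messages\<close>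

text \<open>The image of the sample space may contain values taken only on null events and may miss
  others. The sum is therefore moved to a fixed set that carries the distribution.\<close>

lemma (in prob_space) rv_entropy_eq_sum:
  assumes U: "simple_function M U" and S: "finite S"
    and out: "\<And>u. u \<notin> S \<Longrightarrow> prob (U -` {u} \<inter> space M) = 0"
  shows "rv_entropy U = - (\<Sum>u\<in>S. prob (U -` {u} \<inter> space M) * log 2 (prob (U -` {u} \<inter> space M)))"
proof -
  interpret information_space M 2 by unfold_locales simp
  have "simple_distributed M U (\<lambda>u. prob (U -` {u} \<inter> space M))"
    using U by (rule simple_distributedI) auto
  note entropy_simple_distributed[OF this]
  moreover have "(\<Sum>u\<in>U ` space M. prob (U -` {u} \<inter> space M) * log 2 (prob (U -` {u} \<inter> space M)))
      = (\<Sum>u\<in>S. prob (U -` {u} \<inter> space M) * log 2 (prob (U -` {u} \<inter> space M)))"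
  proof (rule sum.mono_neutral_cong)
    fix u assume "u \<in> S - U ` space M"
    then have "U -` {u} \<inter> space M = {}" by auto
    then show "prob (U -` {u} \<inter> space M) * log 2 (prob (U -` {u} \<inter> space M)) = 0" by (simp only: measure_empty mult_zero_left)
  qed (use S U out in \<open>auto simp: simple_functionD\<close>)
  ultimately show ?thesis by (simp only: rv_entropy_def)
qed

lemma (in prob_space) rv_cond_entropy_eq_sum:
  fixes U :: "'a \<Rightarrow> 'b" and V :: "'a \<Rightarrow> 'c"
  assumes V: "simple_function M V" and U: "simple_function M U" and S: "finite S"
    and out: "\<And>v u. (v, u) \<notin> S \<Longrightarrow> prob {\<omega> \<in> space M. V \<omega> = v \<and> U \<omega> = u} = 0"
  shows "rv_cond_entropy V U = - (\<Sum>(v, u)\<in>S. prob {\<omega> \<in> space M. V \<omega> = v \<and> U \<omega> = u} *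
    log 2 (prob {\<omega> \<in> space M. V \<omega> = v \<and> U \<omega> = u} / prob (U -` {u} \<inter> space M)))"
proof -
  interpret information_space M 2 by unfold_locales simp
  let ?P = "\<lambda>(v, u). prob {\<omega> \<in> space M. V \<omega> = v \<and> U \<omega> = u}"
  have UV: "simple_function M (\<lambda>\<omega>. (V \<omega>, U \<omega>))" using V U by (rule simple_function_Pair)
  have dU: "simple_distributed M U (\<lambda>u. prob (U -` {u} \<inter> space M))"
    using U by (rule simple_distributedI) auto
  have dUV: "simple_distributed M (\<lambda>\<omega>. (V \<omega>, U \<omega>)) ?P"
    using UV by (rule simple_distributedI) (auto intro!: arg_cong[of _ _ prob])
  have "rv_cond_entropy V U = - (\<Sum>(v, u)\<in>(\<lambda>\<omega>. (V \<omega>, U \<omega>)) ` space M.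
      ?P (v, u) * log 2 (?P (v, u) / prob (U -` {u} \<inter> space M)))"
    unfolding rv_cond_entropy_def by (rule conditional_entropy_eq[OF dU dUV])
  also have "(\<Sum>(v, u)\<in>(\<lambda>\<omega>. (V \<omega>, U \<omega>)) ` space M.
      ?P (v, u) * log 2 (?P (v, u) / prob (U -` {u} \<inter> space M)))
    = (\<Sum>(v, u)\<in>S. ?P (v, u) * log 2 (?P (v, u) / prob (U -` {u} \<inter> space M)))"
  proof (rule sum.mono_neutral_cong)
    show "finite ((\<lambda>\<omega>. (V \<omega>, U \<omega>)) ` space M)" using UV by (rule simple_functionD)
  next
    fix z assume z: "z \<in> S - (\<lambda>\<omega>. (V \<omega>, U \<omega>)) ` space M"
    have "{\<omega> \<in> space M. V \<omega> = fst z \<and> U \<omega> = snd z} = {}" using z by force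
    then have "?P z = 0" by (simp only: case_prod_unfold measure_empty)
    then show "(case z of (v, u) \<Rightarrow> ?P (v, u) * log 2 (?P (v, u) / prob (U -` {u} \<inter> space M))) = 0"
      by (simp add: case_prod_unfold)
  qed (use S out in auto)
  finally show ?thesis by simp
qed

lemma sum_symmetric_int:
  fixes F :: "int \<Rightarrow> 'b :: comm_monoid_add"
  shows "sum F {- int N..int N} = F 0 + (\<Sum>i<N. F (int i + 1) + F (- (int i + 1)))"
proof (induction N)
  case (Suc N)
  have "{- int (Suc N)..int (Suc N)} = insert (int N + 1) (insert (- (int N + 1)) {- int N..int N})"
    by auto
  then have "sum F {- int (Suc N)..int (Suc N)} = F (int N + 1) + (F (- (int N + 1)) + sum F {- int N..int N})"
    by simp
  then show ?case by (simp add: Suc ac_simps)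
qed simp

section \<open>Joint distribution of the two messages\<close>

context uniform_source
begin

abbreviation U :: "'a \<Rightarrow> int" where "U \<equiv> U2 \<rho> \<theta> X2 N"
abbreviation V :: "'a \<Rightarrow> int" where "V \<equiv> U1 \<rho> \<theta> X1 X2 N"

lemma measurable_U [measurable]: "U \<in> measurable M (count_space UNIV)"
  unfolding U2_def by measurable

lemma measurable_V [measurable]: "V \<in> measurable M (count_space UNIV)"
proof -
  have "(\<lambda>\<omega>. msg1 \<rho> \<theta> N (U \<omega>) (X1 \<omega>)) \<in> measurable M (count_space UNIV)"
    by (rule measurable_compose_countable[OF _ measurable_U]) measurable
  then show ?thesis unfolding U1_def .
qed

lemma simple_U: "simple_function M U"
proof -
  have "finite (U ` space M)"
    by (rule finite_subset[OF _ finite_msg2]) (auto simp: U2_def)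
  moreover have "U -` {k} \<inter> space M \<in> sets M" for k by measurable
  ultimately show ?thesis unfolding simple_function_def by blast
qed

lemma simple_V: "simple_function M V"
proof -
  have "finite (V ` space M)"
    by (rule finite_subset[of _ "{-1, 0, 1}"]) (use msg1_range in \<open>auto simp: U1_def\<close>)
  moreover have "V -` {k} \<inter> space M \<in> sets M" for k by measurable
  ultimately show ?thesis unfolding simple_function_def by blast
qed

text \<open>Intersecting with the Babai cell discards the heights where \<open>msg2\<close> is
  unspecified, and exactly the rectangle remains.\<close>

lemma prob_UV:
  "prob {\<omega> \<in> space M. V \<omega> = j \<and> U \<omega> = k} =
    (if k \<in> bins \<and> j \<in> {-1, 0, 1} then width k j * ((hi k - lo k) / h) else 0)"
proof -
  define E where "E = {p. msg1 \<rho> \<theta> N k (fst p) = j \<and> msg2 \<rho> \<theta> N (snd p) = k}"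
  have [measurable]: "fst \<in> borel_measurable (borel :: (real \<times> real) measure)"
    "snd \<in> borel_measurable (borel :: (real \<times> real) measure)"
    by (auto intro!: borel_measurable_continuous_onI continuous_intros)
  have E: "E \<in> sets borel"
    unfolding E_def by measurable
  have "{\<omega> \<in> space M. V \<omega> = j \<and> U \<omega> = k} = {\<omega> \<in> space M. (X1 \<omega>, X2 \<omega>) \<in> E}"
    by (auto simp: E_def U1_def U2_def)
  moreover have "babai_cell \<rho> \<theta> \<inter> E = (if k \<in> bins \<and> j \<in> {-1, 0, 1} then rectangle \<rho> \<theta> N k j else {})"
  proof (rule set_eqI)
    fix p :: "real \<times> real"
    obtain x y where p: "p = (x, y)" by (cases p)
    show "p \<in> babai_cell \<rho> \<theta> \<inter> E \<longleftrightarrow> p \<in> (if k \<in> bins \<and> j \<in> {-1, 0, 1} then rectangle \<rho> \<theta> N k j else {})"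
    proof (cases "(x, y) \<in> babai_cell \<rho> \<theta>")
      case True
      then have "- (h/2) < y" "y \<le> h/2" by (auto simp: babai_iff)
      from msg2_iff[OF this] True show ?thesis
        using msg1_range[of k x] unfolding p E_def Int_iff mem_Collect_eq fst_conv snd_conv
        by (auto simp only: rectangle_iff split: if_split)
    qed (auto simp: p rectangle_iff)
  qed
  ultimately show ?thesis
    using prob_X[OF E] measure_rectangle[of k j] by (cases "k \<in> bins \<and> j \<in> {-1, 0, 1}") auto
qed

lemma prob_U: "prob (U -` {k} \<inter> space M) = (if k \<in> bins then (hi k - lo k) / h else 0)"
proof -
  have "prob (U -` {k} \<inter> space M) = (\<Sum>j\<in>{-1, 0, 1}. prob {\<omega> \<in> space M. V \<omega> = j \<and> U \<omega> = k})"
  proof -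
    have "U -` {k} \<inter> space M = (\<Union>j\<in>{-1, 0, 1}. {\<omega> \<in> space M. V \<omega> = j \<and> U \<omega> = k})"
      using msg1_range by (auto simp: U1_def)
    also have "prob \<dots> = (\<Sum>j\<in>{-1, 0, 1}. prob {\<omega> \<in> space M. V \<omega> = j \<and> U \<omega> = k})"
      by (intro finite_measure_finite_Union) (auto simp: disjoint_family_on_def)
    finally show ?thesis .
  qed
  also have "\<dots> = (if k \<in> bins then (width k (-1) + width k 0 + width k 1) * ((hi k - lo k) / h) else 0)"
    unfolding prob_UV by (cases "k \<in> bins") (auto simp: distrib_right add_divide_distrib)
  also have "width k (-1) + width k 0 + width k 1 = 1" by (simp add: width_def)
  finally show ?thesis by simp
qed

lemma prob_X1:
  assumes "A \<in> sets borel"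
  shows "prob {\<omega> \<in> space M. X1 \<omega> \<in> A} = measure lborel ({- (1/2)<..1/2} \<inter> A)"
proof -
  have "prob {\<omega> \<in> space M. X1 \<omega> \<in> A} = prob {\<omega> \<in> space M. (X1 \<omega>, X2 \<omega>) \<in> A \<times> UNIV}" by simp
  also have "\<dots> = measure lborel (babai_cell \<rho> \<theta> \<inter> A \<times> UNIV) / h"
    using assms by (intro prob_X borel_Times) auto
  also have "babai_cell \<rho> \<theta> \<inter> A \<times> UNIV = ({- (1/2)<..1/2} \<inter> A) \<times> {- (h/2)<..h/2}"
    unfolding babai_Times by auto
  also have "measure lborel \<dots> = measure lborel ({- (1/2)<..1/2} \<inter> A) * h"
    using assms h_pos unfolding measure_def by (subst emeasure_Times_real) (auto simp: enn2real_mult)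
  finally show ?thesis using h_pos by simp
qed

lemma P_vec_eq:
  assumes "- (h/2) < y" "y \<le> h/2"
  shows "P_vec M X1 \<rho> \<theta> y =
    [left_thr \<rho> \<theta> y + 1/2, right_thr \<rho> \<theta> y - left_thr \<rho> \<theta> y, 1/2 - right_thr \<rho> \<theta> y]"
proof -
  let ?l = "left_thr \<rho> \<theta> y" and ?r = "right_thr \<rho> \<theta> y"
  note t = thr_order[OF assms]
  have "{- (1/2)<..1/2} \<inter> {..<?l} = {- (1/2)<..<?l}" "{- (1/2)<..1/2} \<inter> {?r<..} = {?r<..1/2}"
    "{- (1/2)<..1/2} \<inter> {?l..?r} = {?l..?r} - {- (1/2)}"
    using t by auto
  then have "prob {\<omega> \<in> space M. X1 \<omega> < ?l} = measure lborel {- (1/2)<..<?l}"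
    "prob {\<omega> \<in> space M. ?r < X1 \<omega>} = measure lborel {?r<..1/2}"
    "prob {\<omega> \<in> space M. ?l \<le> X1 \<omega> \<and> X1 \<omega> \<le> ?r} = measure lborel ({?l..?r} - {- (1/2)})"
    using prob_X1[of "{..<?l}"] prob_X1[of "{?r<..}"] prob_X1[of "{?l..?r}"] by simp_all
  moreover have "measure lborel ({?l..?r} - {- (1/2)}) = measure lborel {?l..?r}"
    by (rule measure_Diff_null_set) auto
  ultimately show ?thesis using t by (simp add: P_vec_def)
qed

end

section \<open>Continuity and symmetry of the reply entropy\<close>

lemma vec_entropy_swap: "vec_entropy [p, q, r] = vec_entropy [r, q, p]"
  by (simp add: vec_entropy_def)

text \<open>At 0 the value \<open>0 * log 2 0\<close> is 0 and agrees with the limit.\<close>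

lemma continuous_on_xlogx: "continuous_on {0..} (\<lambda>p :: real. p * log 2 p)"
proof -
  have "((\<lambda>p :: real. p * log 2 p) \<longlongrightarrow> 0) (at_right 0)" by real_asymp
  then have "continuous (at 0 within {0..}) (\<lambda>p :: real. p * log 2 p)"
    by (simp add: continuous_within at_within_Ici_at_right)
  moreover have "continuous (at p within {0..}) (\<lambda>p :: real. p * log 2 p)" if "0 < p" for p
    using that by (intro continuous_intros) auto
  ultimately show ?thesis
    unfolding continuous_on_eq_continuous_within by (metis atLeast_iff order_le_less)
qed

context hexagonal_cell
begin

text \<open>Entropy of the reply when \<open>x\<^sub>2\<close> lies at distance \<open>s\<close> outside the central strip.\<close>

definition reply_entropy :: "real \<Rightarrow> real" where
  "reply_entropy s = vec_entropy [h / (1 - a) * s, 1 - h / (1 - a) * s - h / a * s, h / a * s]"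

lemma continuous_reply_entropy: "continuous_on {0..\<eta>} reply_entropy"
proof -
  have *: "continuous_on {0..\<eta>} (\<lambda>s. - (p s) * log 2 (p s))"
    if "continuous_on {0..\<eta>} p" "\<And>s. s \<in> {0..\<eta>} \<Longrightarrow> 0 \<le> p s" for p :: "real \<Rightarrow> real"
  proof -
    have "continuous_on {0..\<eta>} (\<lambda>s. p s * log 2 (p s))"
      by (rule continuous_on_compose2[OF continuous_on_xlogx that(1)]) (use that(2) in auto)
    from continuous_on_minus[OF this] show ?thesis by simp
  qed
  have sum: "h / (1 - a) + h / a = 1 / (2 * \<eta>)"
    using a h_pos by (simp add: eta_eq field_simps)
  \<comment> \<open>Continuity of p log p is available for p \<ge> 0 only. The outer entries sum to
    \<open>s / (2 * \<eta>)\<close>, so the middle entry stays nonnegative.\<close>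
  have nonneg: "0 \<le> 1 - h / (1 - a) * s - h / a * s" if "s \<in> {0..\<eta>}" for s
  proof -
    have "h / (1 - a) * s + h / a * s = s / (2 * \<eta>)" by (simp only: distrib_right[symmetric] sum) simp
    also have "\<dots> \<le> 1" using that eta_pos by (simp add: field_simps)
    finally show ?thesis by (simp only: diff_diff_eq diff_ge_0_iff_ge)
  qed
  show ?thesis
    unfolding reply_entropy_def vec_entropy_def list.map sum_list.Cons sum_list.Nil
    using a h_pos nonneg by (intro continuous_on_add * continuous_intros) auto
qed

text \<open>Below the axis \<open>a\<close> and \<open>1 - a\<close> change roles, which only
  reverses the probability vector. Hence both halves give the same entropy, the source of the factor
  2 in \<open>kappa\<close>.\<close>

lemma vec_entropy_thr:
  assumes "- (h/2) < y" "y \<le> h/2" "\<tau> \<le> \<bar>y\<bar>"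
  shows "vec_entropy [left_thr \<rho> \<theta> y + 1/2, right_thr \<rho> \<theta> y - left_thr \<rho> \<theta> y, 1/2 - right_thr \<rho> \<theta> y]
    = reply_entropy (\<bar>y\<bar> - \<tau>)"
proof -
  have *: "- wall b z + 1/2 = h / b * (z - \<tau>)" "1/2 - wall b z = h / b * (z - \<tau>)" for b z
    by (simp_all add: wall_def)
  have mid: "wall b z - (- wall c z) = 1 - h / c * (z - \<tau>) - h / b * (z - \<tau>)" for b c z
    by (simp add: wall_def)
  have "vec_entropy [left_thr \<rho> \<theta> y + 1/2, right_thr \<rho> \<theta> y - left_thr \<rho> \<theta> y, 1/2 - right_thr \<rho> \<theta> y]
      = vec_entropy [h / (1 - side y) * (\<bar>y\<bar> - \<tau>), 1 - h / (1 - side y) * (\<bar>y\<bar> - \<tau>) - h / side y * (\<bar>y\<bar> - \<tau>),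
          h / side y * (\<bar>y\<bar> - \<tau>)]"
    by (simp only: thr_outside[OF assms] * mid)
  also have "\<dots> = reply_entropy (\<bar>y\<bar> - \<tau>)"
  proof (cases "y \<ge> 0")
    case False
    have "1 - h / a * z - h / (1 - a) * z = 1 - h / (1 - a) * z - h / a * z" "1 - (1 - a) = a" for z
      by simp_all
    then show ?thesis using False by (simp only: side_def reply_entropy_def if_False vec_entropy_swap)
  qed (simp add: side_def reply_entropy_def)
  finally show ?thesis .
qed

end

section \<open>Exact rate and error probability at fixed N\<close>

context uniform_source
begin

text \<open>An exact formula for every N: given the bin, reply \<open>j\<close> has probability
  \<open>width k j\<close>, fixed by the thresholds at the midpoint. The central bin has vector (0,
  1, 0) and contributes nothing.\<close>

lemma reply_bits_eq:
  "reply_bits M X1 X2 \<rho> \<theta> N = 2 / h * (\<delta> * (\<Sum>i<N. reply_entropy ((real i + 1/2) * \<delta>)))"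
proof -
  let ?S = "{-1, 0, 1 :: int} \<times> bins"
  let ?p = "\<lambda>k. (hi k - lo k) / h"
  have p: "0 < ?p k" for k using lo_less_hi[of k] h_pos by simp
  have "rv_cond_entropy V U = - (\<Sum>(j, k)\<in>?S. prob {\<omega> \<in> space M. V \<omega> = j \<and> U \<omega> = k} *
    log 2 (prob {\<omega> \<in> space M. V \<omega> = j \<and> U \<omega> = k} / prob (U -` {k} \<inter> space M)))"
    by (rule rv_cond_entropy_eq_sum[OF simple_V simple_U]) (auto simp: prob_UV)
  also have "\<dots> = - (\<Sum>(j, k)\<in>?S. ?p k * (width k j * log 2 (width k j)))"
  proof (intro arg_cong[of _ _ uminus] sum.cong refl)
    fix z assume "z \<in> ?S"
    then obtain j k where z: "z = (j, k)" "j \<in> {-1, 0, 1}" "k \<in> bins" by auto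
    have "width k j * ?p k / ?p k = width k j"
      using less_imp_neq[OF p[of k], symmetric] by (rule nonzero_mult_div_cancel_right)
    then show "(case z of (j, k) \<Rightarrow> prob {\<omega> \<in> space M. V \<omega> = j \<and> U \<omega> = k} *
        log 2 (prob {\<omega> \<in> space M. V \<omega> = j \<and> U \<omega> = k} / prob (U -` {k} \<inter> space M)))
      = (case z of (j, k) \<Rightarrow> ?p k * (width k j * log 2 (width k j)))"
      unfolding z(1) case_prod_conv prob_UV prob_U using z(2,3) by (simp only: simp_thms if_True ac_simps)
  qed
  also have "\<dots> = (\<Sum>k\<in>bins. ?p k * vec_entropy [width k (-1), width k 0, width k 1])"
    unfolding sum.cartesian_product[symmetric] sum_negf[symmetric]
    by (subst sum.swap) (simp add: vec_entropy_def distrib_left right_diff_distrib sum_negf[symmetric])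
  also have "\<dots> = (\<Sum>k\<in>bins. if k = 0 then 0 else \<delta> / h * reply_entropy ((\<bar>of_int k\<bar> - 1/2) * \<delta>))"
  proof (intro sum.cong refl)
    fix k assume k: "k \<in> bins"
    note m = mid_bounds[OF k]
    have w: "[width k (-1), width k 0, width k 1] =
      [left_thr \<rho> \<theta> (mid k) + 1/2, right_thr \<rho> \<theta> (mid k) - left_thr \<rho> \<theta> (mid k), 1/2 - right_thr \<rho> \<theta> (mid k)]"
      by (simp add: width_def)
    show "?p k * vec_entropy [width k (-1), width k 0, width k 1] =
      (if k = 0 then 0 else \<delta> / h * reply_entropy ((\<bar>of_int k\<bar> - 1/2) * \<delta>))"
    proof (cases "k = 0")
      case True
      have "\<bar>0\<bar> < \<tau>" using tau_pos by simp
      note t = thr_inside[OF this]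
      have "vec_entropy [width k (-1), width k 0, width k 1] = 0"
        unfolding w unfolding True mid_0 t by (simp add: vec_entropy_def)
      then show ?thesis using True by simp
    next
      case False
      have "vec_entropy [width k (-1), width k 0, width k 1] = reply_entropy (\<bar>mid k\<bar> - \<tau>)"
        unfolding w using vec_entropy_thr[OF m(1,2)] bin_outer(1)[OF False k] by simp
      then show ?thesis using False abs_mid_eq[OF False] bin_length[of k] by simp
    qed
  qed
  also have "\<dots> = (\<Sum>i<N. 2 * (\<delta> / h * reply_entropy ((real i + 1/2) * \<delta>)))"
  proof -
    \<comment> \<open>Bin \<open>i + 1\<close> and its mirror image have midpoints at the same
      distance \<open>(i + 1/2) * \<delta>\<close> from the strip.\<close>
    have "\<bar>real_of_int (int i + 1)\<bar> - 1/2 = real i + 1/2" "\<bar>real_of_int (- (int i + 1))\<bar> - 1/2 = real i + 1/2" for i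
      by simp_all
    moreover have "int i + 1 \<noteq> 0" "- (int i + 1) \<noteq> 0" for i by simp_all
    ultimately show ?thesis unfolding sum_symmetric_int by (simp only: if_False if_True simp_thms mult_2[symmetric] add_0)
  qed
  also have "\<dots> = 2 / h * (\<delta> * (\<Sum>i<N. reply_entropy ((real i + 1/2) * \<delta>)))"
    by (simp add: sum_distrib_left mult.assoc)
  finally show ?thesis unfolding reply_bits_def .
qed

text \<open>The 2N outer bins have probability H_1/(H N) each. Splitting off log N weights it by
  their total probability 1 - Q_0 and leaves the entropy of \<open>Q\<close>.\<close>

lemma U_entropy: "rv_entropy U = vec_entropy (Q \<rho> \<theta>) + (1 - Q0 \<rho> \<theta>) * log 2 (real N)"
proof -
  let ?p = "\<lambda>k. (hi k - lo k) / h"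
  have "rv_entropy U = - (\<Sum>k\<in>bins. prob (U -` {k} \<inter> space M) * log 2 (prob (U -` {k} \<inter> space M)))"
    by (rule rv_entropy_eq_sum[OF simple_U]) (auto simp: prob_U)
  also have "\<dots> = - (\<Sum>k\<in>bins. ?p k * log 2 (?p k))"
    by (simp add: prob_U)
  also have "\<dots> = - (2 * \<tau> / h * log 2 (2 * \<tau> / h) + 2 * real N * (\<delta> / h * log 2 (\<delta> / h)))"
    unfolding sum_symmetric_int bin_length by (simp del: of_nat_Suc)
  also have "2 * real N * (\<delta> / h * log 2 (\<delta> / h)) = 2 * (\<eta> / h) * log 2 (\<delta> / h)"
    by (simp add: N_delta[symmetric])
  also have "log 2 (\<delta> / h) = log 2 (\<eta> / h) - log 2 (real N)"
    using eta_pos h_pos N unfolding \<delta>_def by (subst log_divide_pos[symmetric]) (auto simp: ac_simps)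
  also have "2 * \<tau> = h - 2 * \<eta>" using tau_eta by simp
  finally show ?thesis
    using h_pos by (simp add: vec_entropy_def Q_def Q0_def H0_def h_def[symmetric] \<eta>_def[symmetric] diff_divide_distrib algebra_simps)
qed

lemma total_bits_eq: "total_bits M X1 X2 \<rho> \<theta> N =
    vec_entropy (Q \<rho> \<theta>) + (1 - Q0 \<rho> \<theta>) * log 2 (real N) + reply_bits M X1 X2 \<rho> \<theta> N"
  by (simp add: total_bits_def U_entropy)

text \<open>The shift cancels: 2 L_2 + L_1 = 1/2.\<close>

lemma beta_eq: "beta \<rho> \<theta> = \<eta> / (4 * h)"
  by (simp add: beta_def L1_def L2_def cell_length_def \<eta>_def[symmetric] h_def[symmetric] field_simps)

lemma error_prob_eq:
  assumes d: "decision_rule \<rho> \<theta> N d"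
  shows "error_prob M X1 X2 \<rho> \<theta> d N = beta \<rho> \<theta> / real N"
proof -
  define E where "E = {p. p \<notin> voronoi \<rho> \<theta> (d (msg2 \<rho> \<theta> N (snd p)) (msg1 \<rho> \<theta> N (msg2 \<rho> \<theta> N (snd p)) (fst p)))}"
  define R where "R = (\<lambda>(k, j). rectangle \<rho> \<theta> N k j - voronoi \<rho> \<theta> (d k j))"
  let ?S = "bins \<times> {-1, 0, 1 :: int}"
  have [measurable]: "fst \<in> borel_measurable (borel :: (real \<times> real) measure)"
    "snd \<in> borel_measurable (borel :: (real \<times> real) measure)"
    by (auto intro!: borel_measurable_continuous_onI continuous_intros)
  \<comment> \<open>\<open>d\<close> is an arbitrary function of the messages; fixing the two
    integer messages turns its error set into a countable union of Borel sets.\<close>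
  have "E = (\<Union>k. \<Union>j. {p. msg2 \<rho> \<theta> N (snd p) = k} \<inter> {p. msg1 \<rho> \<theta> N k (fst p) = j} - voronoi \<rho> \<theta> (d k j))"
    unfolding E_def by auto
  moreover have "{p :: real \<times> real. msg2 \<rho> \<theta> N (snd p) = k} \<in> sets borel" for k by measurable
  moreover have "{p :: real \<times> real. msg1 \<rho> \<theta> N k (fst p) = j} \<in> sets borel" for k j by measurable
  ultimately have E: "E \<in> sets borel" by (auto intro!: sets.Diff sets.countable_UN)
  have "error_prob M X1 X2 \<rho> \<theta> d N = prob {\<omega> \<in> space M. (X1 \<omega>, X2 \<omega>) \<in> E}"
    by (simp add: error_prob_def E_def U1_def U2_def)
  also have "\<dots> = measure lborel (babai_cell \<rho> \<theta> \<inter> E) / h" by (rule prob_X[OF E])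
  also have "babai_cell \<rho> \<theta> \<inter> E = (\<Union>z\<in>?S. R z)"
  proof (rule set_eqI)
    fix p :: "real \<times> real"
    obtain x y where p: "p = (x, y)" by (cases p)
    show "p \<in> babai_cell \<rho> \<theta> \<inter> E \<longleftrightarrow> p \<in> (\<Union>z\<in>?S. R z)"
    proof (cases "(x, y) \<in> babai_cell \<rho> \<theta>")
      case True
      then have "- (h/2) < y" "y \<le> h/2" by (auto simp: babai_iff)
      note iff = msg2_iff[OF this]
      obtain k j where kj: "msg2 \<rho> \<theta> N y = k" "msg1 \<rho> \<theta> N k x = j" by blast
      then have k: "k \<in> bins" "y \<in> bin \<rho> \<theta> N k" and j: "j \<in> {-1, 0, 1}" using iff msg1_range by blast+
      have "p \<in> babai_cell \<rho> \<theta> \<inter> E \<longleftrightarrow> p \<notin> voronoi \<rho> \<theta> (d k j)"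
        using True by (simp add: E_def p kj)
      also have "\<dots> \<longleftrightarrow> p \<in> (\<Union>z\<in>?S. R z)"
      proof -
        have rect: "p \<in> rectangle \<rho> \<theta> N k' j' \<longleftrightarrow> k' = k \<and> j' = j" for k' j'
        proof (cases "k' = k")
          case False
          then have "y \<notin> bin \<rho> \<theta> N k'" using bin_disjoint[OF k(2)] by auto
          then show ?thesis unfolding p rectangle_iff using False by simp
        qed (use True k(2) kj(2) in \<open>auto simp: p rectangle_iff\<close>)
        have "p \<in> R (k', j') \<longleftrightarrow> (k', j') = (k, j) \<and> p \<notin> voronoi \<rho> \<theta> (d k j)" for k' j'
          unfolding R_def case_prod_conv Diff_iff rect by auto
        moreover have "(k, j) \<in> ?S" using k j by simp
        ultimately show ?thesis by (metis (no_types, lifting) UN_iff surj_pair)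
      qed
      finally show ?thesis .
    qed (auto simp: p rectangle_iff R_def)
  qed
  also have "measure lborel (\<Union>z\<in>?S. R z) = (\<Sum>z\<in>?S. measure lborel (R z))"
  proof (rule measure_finite_Union)
    show "R ` ?S \<subseteq> sets lborel" using rectangle_borel by (auto simp: R_def)
    show "disjoint_family_on R ?S"
    proof -
      have "k = k' \<and> j = j'" if "p \<in> R (k, j)" "p \<in> R (k', j')" for p k j k' j'
      proof -
        obtain x y where p: "p = (x, y)" by (cases p)
        have "k = k'" using that bin_disjoint[of y k k'] by (simp add: R_def p rectangle_iff)
        then show ?thesis using that by (auto simp: R_def p rectangle_iff)
      qed
      then show ?thesis unfolding disjoint_family_on_def by fast
    qed
    fix z assume "z \<in> ?S"
    then obtain k j where z: "z = (k, j)" "k \<in> bins" "j \<in> {-1, 0, 1}" by auto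
    have "emeasure lborel (R z) \<le> emeasure lborel (rectangle \<rho> \<theta> N k j)"
      using rectangle_borel z by (intro emeasure_mono) (auto simp: R_def)
    then show "emeasure lborel (R z) \<noteq> \<infinity>" by (auto simp: emeasure_rectangle[OF z(2,3)] top_unique)
  qed simp
  also have "\<dots> = (\<Sum>k\<in>bins. \<Sum>j\<in>{-1, 0, 1}. slope k j * \<delta>\<^sup>2 / 8)"
    unfolding sum.cartesian_product
    by (intro sum.cong refl) (auto simp: R_def measure_rectangle_error[OF d])
  also have "\<dots> = (\<Sum>k\<in>bins. if k = 0 then 0 else \<delta>\<^sup>2 / (8 * \<eta>))"
  proof (intro sum.cong refl)
    fix k
    have "(\<Sum>j\<in>{-1, 0, 1}. slope k j * \<delta>\<^sup>2 / 8) = (slope k 1 + slope k (-1) + slope k 0) * \<delta>\<^sup>2 / 8"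
      by (simp add: algebra_simps add_divide_distrib)
    \<comment> \<open>Replies 1 and -1 together cost as much area as reply 0.\<close>
    also have "\<dots> = 2 * slope k 0 * \<delta>\<^sup>2 / 8" by (simp add: slope_split)
    also have "\<dots> = (if k = 0 then 0 else \<delta>\<^sup>2 / (8 * \<eta>))"
      using slope_sum[of k] by (simp add: slope_def)
    finally show "(\<Sum>j\<in>{-1, 0, 1}. slope k j * \<delta>\<^sup>2 / 8) = (if k = 0 then 0 else \<delta>\<^sup>2 / (8 * \<eta>))" .
  qed
  also have "\<dots> = 2 * real N * (\<delta>\<^sup>2 / (8 * \<eta>))"
    unfolding sum_symmetric_int by (simp del: of_nat_Suc)
  also have "\<dots> / h = \<eta> / (4 * h) / real N"
    using eta_pos h_pos N by (simp add: \<delta>_def power2_eq_square field_simps)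
  finally show ?thesis by (simp only: beta_eq)
qed

end

section \<open>The limit\<close>

lemma (in hexagonal_cell) Q0_lt_1: "0 < 1 - Q0 \<rho> \<theta>"
  using eta_pos h_pos by (simp add: Q0_def H0_def h_def[symmetric] \<eta>_def[symmetric] field_simps)

text \<open>The source without a fixed N, for the statements in which N tends to infinity.\<close>

locale uniform_hexagonal = hexagonal_cell + prob_space M for M :: "'a measure" +
  fixes X1 X2 :: "'a \<Rightarrow> real"
  assumes X1: "X1 \<in> borel_measurable M" and X2: "X2 \<in> borel_measurable M"
    and unif: "distr M lborel (\<lambda>\<omega>. (X1 \<omega>, X2 \<omega>)) = uniform_measure lborel (babai_cell \<rho> \<theta>)"
begin

lemma uniform_source: "N \<ge> 1 \<Longrightarrow> uniform_source \<rho> \<theta> N M X1 X2"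
  by unfold_locales (use X1 X2 unif in auto)

abbreviation f :: "real \<Rightarrow> real" where "f x \<equiv> vec_entropy (P_vec M X1 \<rho> \<theta> x)"

lemma f_eq: "- (h/2) < x \<Longrightarrow> x \<le> - \<tau> \<Longrightarrow> f x = reply_entropy (- x - \<tau>)"
proof -
  assume x: "- (h/2) < x" "x \<le> - \<tau>"
  interpret uniform_source \<rho> \<theta> 1 M X1 X2 by (rule uniform_source) simp
  have "x \<le> h/2" "\<tau> \<le> \<bar>x\<bar>" "\<bar>x\<bar> = - x" using x tau_pos h_pos by auto
  then show ?thesis using P_vec_eq[of x] vec_entropy_thr[of x] x by simp
qed

lemma continuous_reflected: "continuous_on {- (h/2)..- \<tau>} (\<lambda>x. reply_entropy (- x - \<tau>))"
  by (rule continuous_on_compose2[OF continuous_reply_entropy])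
    (use tau_eta in \<open>auto intro!: continuous_intros\<close>)

lemma
  shows f_integrable: "set_integrable lborel {- (h/2)..- \<tau>} f"
    and f_integral: "(LINT x:{- (h/2)..- \<tau>}|lborel. f x) = integral {- (h/2)..- \<tau>} (\<lambda>x. reply_entropy (- x - \<tau>))"
proof -
  let ?I = "{- (h/2)..- \<tau>}"
  have G: "set_integrable lborel ?I (\<lambda>x. reply_entropy (- x - \<tau>))"
    using continuous_reflected by (rule borel_integrable_atLeastAtMost')
  \<comment> \<open>At the bottom edge \<open>- (h/2)\<close> the thresholds come from an empty
    section and \<open>f\<close> is unknown there; a single point does not affect the
    integral.\<close>
  have eq: "indicator ?I x *\<^sub>R f x = indicator ?I x *\<^sub>R reply_entropy (- x - \<tau>)" if "x \<notin> {- (h/2)}" for x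
    using f_eq[of x] that by (auto simp: indicator_def)
  show "set_integrable lborel ?I f"
    using G unfolding set_integrable_def
    by (subst integrable_discrete_difference[where X = "{- (h/2)}"]) (use eq in auto)
  have "(LINT x:?I|lborel. f x) = (LINT x:?I|lborel. reply_entropy (- x - \<tau>))"
    unfolding set_lebesgue_integral_def
    by (rule integral_discrete_difference[where X = "{- (h/2)}"]) (use eq in auto)
  also have "\<dots> = integral ?I (\<lambda>x. reply_entropy (- x - \<tau>))"
    using G by (rule set_borel_integral_eq_integral)
  finally show "(LINT x:?I|lborel. f x) = integral ?I (\<lambda>x. reply_entropy (- x - \<tau>))" .
qed

lemma reply_bits_tendsto:
  "(\<lambda>N. reply_bits M X1 X2 \<rho> \<theta> N) \<longlonglongrightarrow> 2 / h * (LINT x:{- (h/2)..- \<tau>}|lborel. f x)"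
proof -
  let ?G = "\<lambda>x. reply_entropy (- x - \<tau>)"
  have w: "- \<tau> - - (h/2) = \<eta>" using tau_eta by simp
  have "(\<lambda>N. \<eta> / real N * (\<Sum>i<N. ?G (- (h/2) + (real i + 1/2) * (\<eta> / real N)))) \<longlonglongrightarrow> integral {- (h/2)..- \<tau>} ?G"
    using riemann_midpoint_sums[OF _ continuous_reflected] eta_pos w by simp
  then have "(\<lambda>N. 2 / h * (\<eta> / real N * (\<Sum>i<N. ?G (- (h/2) + (real i + 1/2) * (\<eta> / real N)))))
      \<longlonglongrightarrow> 2 / h * (LINT x:{- (h/2)..- \<tau>}|lborel. f x)"
    unfolding f_integral by (rule tendsto_mult_left)
  moreover have "\<forall>\<^sub>F N in sequentially. 2 / h * (\<eta> / real N * (\<Sum>i<N. ?G (- (h/2) + (real i + 1/2) * (\<eta> / real N))))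
      = reply_bits M X1 X2 \<rho> \<theta> N"
  proof (rule eventually_sequentiallyI[of 1])
    fix N :: nat assume "1 \<le> N"
    then interpret uniform_source \<rho> \<theta> N M X1 X2 by (rule uniform_source)
    \<comment> \<open>From the bottom edge upwards the midpoints are met from the outermost bin
      inwards, whereas \<open>reply_bits_eq\<close> counts outwards, so the index is
      reversed.\<close>
    have "(\<Sum>i<N. ?G (- (h/2) + (real i + 1/2) * \<delta>)) = (\<Sum>i<N. reply_entropy ((real (N - Suc i) + 1/2) * \<delta>))"
    proof (intro sum.cong refl arg_cong[of _ _ reply_entropy])
      fix i assume "i \<in> {..<N}"
      then have "real (N - Suc i) = real N - 1 - real i" by (simp add: of_nat_diff)
      then have "(real (N - Suc i) + 1/2) * \<delta> = real N * \<delta> - (real i + 1/2) * \<delta>" by (simp add: algebra_simps)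
      then show "- (- (h/2) + (real i + 1/2) * \<delta>) - \<tau> = (real (N - Suc i) + 1/2) * \<delta>"
        using N_delta tau_eta by simp
    qed
    also have "\<dots> = (\<Sum>i<N. reply_entropy ((real i + 1/2) * \<delta>))"
      by (rule sum.nat_diff_reindex)
    finally show "2 / h * (\<eta> / real N * (\<Sum>i<N. ?G (- (h/2) + (real i + 1/2) * (\<eta> / real N))))
      = reply_bits M X1 X2 \<rho> \<theta> N"
      by (simp only: reply_bits_eq \<delta>_def[symmetric])
  qed
  ultimately show ?thesis by (rule Lim_transform_eventually)
qed

lemma kappa_eq: "kappa M X1 X2 \<rho> \<theta> = 2 / h * (LINT x:{- (h/2)..- \<tau>}|lborel. f x)"
  unfolding kappa_def by (rule limI[OF reply_bits_tendsto])

end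

theorem mainTheorem3:
  fixes M :: "'a measure" and X1 X2 :: "'a \<Rightarrow> real" and \<rho> \<theta> :: real
    and d :: "nat \<Rightarrow> int \<Rightarrow> int \<Rightarrow> real \<times> real"
  assumes "\<rho> \<ge> 1" and "0 < \<theta>" and "\<theta> < pi / 2"
    and "0 < \<rho> * cos \<theta>" and "\<rho> * cos \<theta> < 1 / 2"
    and "prob_space M"
    and "X1 \<in> borel_measurable M" and "X2 \<in> borel_measurable M"
    and "distr M lborel (\<lambda>\<omega>. (X1 \<omega>, X2 \<omega>)) = uniform_measure lborel (babai_cell \<rho> \<theta>)"
    and "\<And>N. N \<ge> 1 \<Longrightarrow> decision_rule \<rho> \<theta> N (d N)"
  shows
    "convergent (\<lambda>N. reply_bits M X1 X2 \<rho> \<theta> N)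
     \<and> set_integrable lborel {-(\<rho> * sin \<theta> / 2)..tau_m1 \<rho> \<theta>}
         (\<lambda>x. vec_entropy (P_vec M X1 \<rho> \<theta> x))
     \<and> kappa M X1 X2 \<rho> \<theta> =
         2 / cell_height \<rho> \<theta> *
           (LINT x:{-(\<rho> * sin \<theta> / 2)..tau_m1 \<rho> \<theta>}|lborel. vec_entropy (P_vec M X1 \<rho> \<theta> x))
     \<and> (\<forall>N\<ge>1. total_bits M X1 X2 \<rho> \<theta> N =
           vec_entropy (Q \<rho> \<theta>) + (1 - Q0 \<rho> \<theta>) * log 2 (real N) + reply_bits M X1 X2 \<rho> \<theta> N)
     \<and> (\<lambda>N. total_bits M X1 X2 \<rho> \<theta> N
           - (vec_entropy (Q \<rho> \<theta>) + (1 - Q0 \<rho> \<theta>) * log 2 (real N) + kappa M X1 X2 \<rho> \<theta>))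
         \<longlonglongrightarrow> 0
     \<and> (\<forall>N\<ge>1. error_prob M X1 X2 \<rho> \<theta> (d N) N = beta \<rho> \<theta> / real N)
     \<and> (\<lambda>N. error_prob M X1 X2 \<rho> \<theta> (d N) N
             * 2 powr (total_bits M X1 X2 \<rho> \<theta> N / (1 - Q0 \<rho> \<theta>)))
         \<longlonglongrightarrow> beta \<rho> \<theta> * 2 powr ((vec_entropy (Q \<rho> \<theta>) + kappa M X1 X2 \<rho> \<theta>) / (1 - Q0 \<rho> \<theta>))"
proof -
  interpret prob_space M by (rule assms(6))
  interpret uniform_hexagonal \<rho> \<theta> M X1 X2
    using assms by unfold_locales auto
  let ?R = "reply_bits M X1 X2 \<rho> \<theta>" and ?T = "total_bits M X1 X2 \<rho> \<theta>" and ?\<kappa> = "kappa M X1 X2 \<rho> \<theta>"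
  let ?E = "vec_entropy (Q \<rho> \<theta>)" and ?q = "1 - Q0 \<rho> \<theta>" and ?\<beta> = "beta \<rho> \<theta>"
  have ivl: "- (\<rho> * sin \<theta> / 2) = - (h/2)" "tau_m1 \<rho> \<theta> = - \<tau>" "cell_height \<rho> \<theta> = h"
    by (simp_all add: h_def cell_height_def tau_m1_eq)
  have lim: "?R \<longlonglongrightarrow> ?\<kappa>" using reply_bits_tendsto by (simp only: kappa_eq)
  have total: "?T N = ?E + ?q * log 2 (real N) + ?R N" if "N \<ge> 1" for N
    using uniform_source.total_bits_eq[OF uniform_source[OF that]] .
  have err: "error_prob M X1 X2 \<rho> \<theta> (d N) N = ?\<beta> / real N" if "N \<ge> 1" for N
    using uniform_source.error_prob_eq[OF uniform_source[OF that] assms(10)[OF that]] .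
  have "(\<lambda>N. ?R N - ?\<kappa>) \<longlonglongrightarrow> 0" using lim by (rule Lim_null[THEN iffD1])
  then have total_lim: "(\<lambda>N. ?T N - (?E + ?q * log 2 (real N) + ?\<kappa>)) \<longlonglongrightarrow> 0"
    by (rule Lim_transform_eventually) (auto intro!: eventually_sequentiallyI[of 1] simp: total)
  have "(\<lambda>N. ?\<beta> * 2 powr ((?E + ?R N) / ?q)) \<longlonglongrightarrow> ?\<beta> * 2 powr ((?E + ?\<kappa>) / ?q)"
    using lim Q0_lt_1 by (intro tendsto_intros) auto
  moreover have "\<forall>\<^sub>F N in sequentially. ?\<beta> * 2 powr ((?E + ?R N) / ?q) =
      error_prob M X1 X2 \<rho> \<theta> (d N) N * 2 powr (?T N / ?q)"
  proof (rule eventually_sequentiallyI[of 1])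
    fix N :: nat assume N: "1 \<le> N"
    \<comment> \<open>Dividing by \<open>?q\<close>, which is positive because H_1 > 0, normalizes
      the coefficient of log N to 1; this is why the exponent of the theorem has this form.\<close>
    have "?T N / ?q = (?E + ?R N) / ?q + log 2 (real N)"
      using Q0_lt_1 by (simp add: total[OF N] field_simps)
    then have "2 powr (?T N / ?q) = 2 powr ((?E + ?R N) / ?q) * real N"
      using N by (simp add: powr_add)
    then show "?\<beta> * 2 powr ((?E + ?R N) / ?q) = error_prob M X1 X2 \<rho> \<theta> (d N) N * 2 powr (?T N / ?q)"
      using N by (simp add: err)
  qed
  ultimately have prod_lim: "(\<lambda>N. error_prob M X1 X2 \<rho> \<theta> (d N) N * 2 powr (?T N / ?q))
      \<longlonglongrightarrow> ?\<beta> * 2 powr ((?E + ?\<kappa>) / ?q)"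
    by (rule Lim_transform_eventually)
  show ?thesis
    unfolding ivl using lim f_integrable kappa_eq total total_lim err prod_lim
    by (auto simp: convergent_def)
qed

end
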